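(* Let $d_x,d_y\ge1$ and let $(\mu,\nu)\in\mathcal P_2(\mathbb R^{d_x})\times\mathcal P_2(\mathbb R^{d_y})$. Let $\widetilde U^\mu:\mathbb R^{d_x}\to L^2(\mathcal W_{d_x},\Lambda_{d_x})$ and $\widetilde V^\nu:\mathbb R^{d_y}\to L^2(\mathcal W_{d_y},\Lambda_{d_y})$ be the global centered half-space embeddings of $\mathbb R^{d_x}$ and $\mathbb R^{d_y}$ (defined in the context). Set $(\widetilde{\mathcal W},\widetilde\Lambda):=(\mathcal W_{d_x}\times\mathcal W_{d_y},\Lambda_{d_x}\otimes\Lambda_{d_y})$, $m_\mu:=\int\|\widetilde U^\mu_x\|^2_{L^2(\mathcal W_{d_x},\Lambda_{d_x})}\,d\mu(x)$ and $m_\nu:=\int\|\widetilde V^\nu_y\|^2_{L^2(\mathcal W_{d_y},\Lambda_{d_y})}\,d\nu(y)$. Then $$D_2^2(\mu,\nu)=E_{\mu,\nu}+\inf_{a\in\mathcal B_{\mu,\nu}}\left\{\frac18\|a\|^2_{L^2(\widetilde{\mathcal W},\widetilde\Lambda)}+T_{\widetilde c_{a,\mu,\nu}}(\mu,\nu)\right\},$$ where $$E_{\mu,\nu}:=\iint\|x-x'\|^2\,d\mu(x)d\mu(x')+\iint\|y-y'\|^2\,d\nu(y)d\nu(y')-\left(\iint\|x-x'\|\,d\mu(x)d\mu(x')\right)\left(\iint\|y-y'\|\,d\nu(y)d\nu(y')\right),$$ $$\mathcal B_{\mu,\nu}:=\left\{a\in L^2(\widetilde{\mathcal W},\widetilde\Lambda):\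 \|a\|_{L^2(\widetilde{\mathcal W},\widetilde\Lambda)}\le 8\sqrt{m_\mu m_\nu}\right\},$$ and for each $a\in\mathcal B_{\mu,\nu}$ the cost $\widetilde c_{a,\mu,\nu}:\mathbb R^{d_x}\times\mathbb R^{d_y}\to\mathbb R$ is $$\widetilde c_{a,\mu,\nu}(x,y)=-4\|\widetilde U^\mu_x\|^2_{L^2(\mathcal W_{d_x},\Lambda_{d_x})}\|\widetilde V^\nu_y\|^2_{L^2(\mathcal W_{d_y},\Lambda_{d_y})}-2\int a(\xi,\zeta)\,\widetilde U^\mu_x(\xi)\,\widetilde V^\nu_y(\zeta)\,d\widetilde\Lambda(\xi,\zeta).$$
   Context: $\mathcal P_p(\mathbb R^d)$ is the set of Borel probability measures on $\mathbb R^d$ with finite $p$-th moment. $\Pi(\mu,\nu)$ is the set of couplings of $\mu$ and $\nu$. The 2-Gromov--Wasserstein distance is defined by $D_2^2(\mu,\nu):=\inf_{\gamma\in\Pi(\mu,\nu)}\iint|\,\|x-x'\|-\|y-y'\|\,|^2\,d\gamma(x,y)d\gamma(x',y')$ (Euclidean norms). For a cost $c$, $T_c(\mu,\nu):=\inf_{\pi\in\Pi(\mu,\nu)}\int c\,d\pi$. Half-spaces: for $d\ge1$, $\mathcal W_d:=\mathbb S^{d-1}\times\mathbb R$, and for $\xi=(\theta,t)\in\mathcal W_d$, $H_\xi=\{x\in\mathbb R^d:\theta\cdot x>t\}$. With $\sigma_{d-1}$ the uniform probability measure on $\mathbb S^{d-1}$ and $a_d:=\mathbb E_{\theta\sim\sigma_{d-1}}|\theta_1|>0$,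 the measure $\Lambda_d$ on $\mathcal W_d$ is $d\Lambda_d(\theta,t):=a_d^{-1}\,d\sigma_{d-1}(\theta)\,dt$ ($dt$ Lebesgue measure). Global centered embedding: for a probability measure $\rho$ on $\mathbb R^d$ with finite first moment and $x\in\mathbb R^d$, the function $\xi\mapsto\mathbf 1_{H_\xi}(x)-\rho(H_\xi)$ belongs to $L^2(\mathcal W_d,\Lambda_d)$. $\widetilde U^\mu_x$ is this function for $(d,\rho)=(d_x,\mu)$, and $\widetilde V^\nu_y$ is this function for $(d,\rho)=(d_y,\nu)$ (with $y\in\mathbb R^{d_y}$ in place of $x$). *)

theory Defs
  imports "HOL-Probability.Probability"
begin

section \<open>Measures with finite moments, couplings, transport functionals\<close>

definition finite_moment_measures :: "real \<Rightarrow> 'a::euclidean_space measure set" where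
  "finite_moment_measures p =
     {\<mu>. prob_space \<mu> \<and> sets \<mu> = sets borel \<and> integrable \<mu> (\<lambda>x. norm x powr p)}"

definition couplings ::
  "'a::euclidean_space measure \<Rightarrow> 'b::euclidean_space measure \<Rightarrow> ('a \<times> 'b) measure set" where
  "couplings \<mu> \<nu> =
     {\<gamma>. prob_space \<gamma> \<and> sets \<gamma> = sets borel \<and>
          distr \<gamma> borel fst = \<mu> \<and> distr \<gamma> borel snd = \<nu>}"

text \<open>The square of the 2-Gromov--Wasserstein distance. For measures with finite second
  moments the integrand is dominated by an integrable function, so that the iterated
  Bochner integral is the usual double integral.\<close>

definition gw2_sq ::
  "'a::euclidean_space measure \<Rightarrow> 'b::euclidean_space measure \<Rightarrow> real" where
  "gw2_sq \<mu> \<nu> =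
     (INF \<gamma> \<in> couplings \<mu> \<nu>.
        \<integral>(x, y). (\<integral>(x', y'). \<bar>norm (x - x') - norm (y - y')\<bar>\<^sup>2 \<partial>\<gamma>) \<partial>\<gamma>)"

definition transport_cost ::
  "('a \<Rightarrow> 'b \<Rightarrow> real) \<Rightarrow> 'a::euclidean_space measure \<Rightarrow> 'b::euclidean_space measure \<Rightarrow> real" where
  "transport_cost c \<mu> \<nu> = (INF \<pi> \<in> couplings \<mu> \<nu>. \<integral>(x, y). c x y \<partial>\<pi>)"


section \<open>Square-integrable functions\<close>

text \<open>Elements of \<open>L\<^sup>2\<close> are represented by functions, not by almost-everywhere classes; all
  quantities below depend only on the class.\<close>

definition L2_space :: "'a measure \<Rightarrow> ('a \<Rightarrow> real) set" where
  "L2_space M = {f \<in> borel_measurable M. integrable M (\<lambda>x. (f x)\<^sup>2)}"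

definition L2_norm_on :: "'a measure \<Rightarrow> ('a \<Rightarrow> real) \<Rightarrow> real" where
  "L2_norm_on M f = sqrt (\<integral>x. (f x)\<^sup>2 \<partial>M)"


section \<open>The half-space measure and the centered embedding\<close>

text \<open>The uniform distribution on the unit sphere is the law of the direction of a uniformly
  distributed point of the unit ball. The map \<open>sgn\<close> sends \<open>x\<close> to \<open>x /\<^sub>R norm x\<close>; its value
  \<open>0\<close> at the origin concerns a null set only.\<close>

definition sphere_uniform :: "'a::euclidean_space measure" where
  "sphere_uniform =
     restrict_space (distr (uniform_measure lborel (ball 0 1)) borel sgn) (sphere 0 1)"

text \<open>The constant \<open>a\<^sub>d\<close>. An abstract Euclidean space has no distinguished first coordinate;
  by rotation invariance the choice of the basis vector does not matter.\<close>

definition sphere_mean_abs :: "'a::euclidean_space itself \<Rightarrow> real" where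
  "sphere_mean_abs _ =
     (\<integral>\<theta>. \<bar>(\<theta> :: 'a) \<bullet> (SOME b. b \<in> Basis)\<bar> \<partial>sphere_uniform)"

definition half_space :: "'a::euclidean_space \<times> real \<Rightarrow> 'a set" where
  "half_space \<xi> = {x. fst \<xi> \<bullet> x > snd \<xi>}"

text \<open>The underlying space of this measure is \<open>sphere 0 1 \<times> UNIV\<close>.\<close>

definition half_space_measure :: "('a::euclidean_space \<times> real) measure" where
  "half_space_measure =
     scale_measure (ennreal (1 / sphere_mean_abs TYPE('a))) (sphere_uniform \<Otimes>\<^sub>M lborel)"

definition centered_embedding ::
  "'a::euclidean_space measure \<Rightarrow> 'a \<Rightarrow> 'a \<times> real \<Rightarrow> real" where
  "centered_embedding \<rho> x \<xi> = indicat_real (half_space \<xi>) x - measure \<rho> (half_space \<xi>)"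

definition embedding_norm_sq :: "'a::euclidean_space measure \<Rightarrow> 'a \<Rightarrow> real" where
  "embedding_norm_sq \<rho> x = (L2_norm_on half_space_measure (centered_embedding \<rho> x))\<^sup>2"

definition mean_embedding_norm_sq :: "'a::euclidean_space measure \<Rightarrow> real" where
  "mean_embedding_norm_sq \<rho> = (\<integral>x. embedding_norm_sq \<rho> x \<partial>\<rho>)"

definition half_space_pair_measure ::
  "(('a::euclidean_space \<times> real) \<times> ('b::euclidean_space \<times> real)) measure" where
  "half_space_pair_measure = half_space_measure \<Otimes>\<^sub>M half_space_measure"


section \<open>The terms of the dual formula\<close>

definition gw_const ::
  "'a::euclidean_space measure \<Rightarrow> 'b::euclidean_space measure \<Rightarrow> real" where
  "gw_const \<mu> \<nu> =
     (\<integral>x. (\<integral>x'. (norm (x - x'))\<^sup>2 \<partial>\<mu>) \<partial>\<mu>) +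
     (\<integral>y. (\<integral>y'. (norm (y - y'))\<^sup>2 \<partial>\<nu>) \<partial>\<nu>) -
     (\<integral>x. (\<integral>x'. norm (x - x') \<partial>\<mu>) \<partial>\<mu>) * (\<integral>y. (\<integral>y'. norm (y - y') \<partial>\<nu>) \<partial>\<nu>)"

definition dual_ball ::
  "'a::euclidean_space measure \<Rightarrow> 'b::euclidean_space measure \<Rightarrow>
   (('a \<times> real) \<times> ('b \<times> real) \<Rightarrow> real) set" where
  "dual_ball \<mu> \<nu> =
     {a \<in> L2_space half_space_pair_measure.
        L2_norm_on half_space_pair_measure a
          \<le> 8 * sqrt (mean_embedding_norm_sq \<mu> * mean_embedding_norm_sq \<nu>)}"

definition dual_cost ::
  "(('a \<times> real) \<times> ('b \<times> real) \<Rightarrow> real) \<Rightarrow>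
   'a::euclidean_space measure \<Rightarrow> 'b::euclidean_space measure \<Rightarrow> 'a \<Rightarrow> 'b \<Rightarrow> real" where
  "dual_cost a \<mu> \<nu> x y =
     - 4 * embedding_norm_sq \<mu> x * embedding_norm_sq \<nu> y
     - 2 * (\<integral>(\<xi>, \<zeta>). a (\<xi>, \<zeta>) * centered_embedding \<mu> x \<xi> * centered_embedding \<nu> y \<zeta>
              \<partial>half_space_pair_measure)"

end

theory Submission
  imports Defs
begin

text \<open>
  The half-space embedding turns distances into squared distances in a Hilbert space: the
  Crofton formula says that the half-spaces separating \<open>x\<close> from \<open>x'\<close> have
  \<open>\<Lambda>\<close>-measure \<open>\<parallel>x - x'\<parallel>\<close>, so \<open>\<parallel>U\<^sub>x - U\<^sub>x\<^sub>'\<parallel>\<^sup>2 = \<parallel>x - x'\<parallel>\<close>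
  (\<open>half_space_crofton\<close>, \<open>embedding_sqdist\<close>). With \<open>u(x) = \<parallel>U\<^sub>x\<parallel>\<^sup>2\<close> and
  \<open>v(y) = \<parallel>V\<^sub>y\<parallel>\<^sup>2\<close> this reads
  \<open>\<parallel>x - x'\<parallel> = u(x) + u(x') - 2\<langle>U\<^sub>x, U\<^sub>x\<^sub>'\<rangle>\<close>, and likewise on the other side.

  Let \<open>\<gamma>\<close> be a coupling. Expanding the square in the distortion of \<open>\<gamma>\<close>, the only term that
  depends on \<open>\<gamma>\<close> is \<open>-2\<integral>\<integral>\<parallel>x - x'\<parallel> \<parallel>y - y'\<parallel> d\<gamma> d\<gamma>\<close>.
  In the product of the two expansions every term that contains exactly one inner product
  integrates to zero, because \<open>U\<close> has mean zero under \<open>\<mu>\<close> and \<open>V\<close> under \<open>\<nu>\<close>. What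
  remains is \<open>2\<integral>uv d\<gamma> + 2 m\<^sub>\<mu> m\<^sub>\<nu>\<close> and
  \<open>4\<integral>\<integral>\<langle>U\<^sub>x, U\<^sub>x\<^sub>'\<rangle>\<langle>V\<^sub>y, V\<^sub>y\<^sub>'\<rangle> d\<gamma> d\<gamma> = 4\<parallel>K\<parallel>\<^sup>2\<close>,
  where \<open>K = \<integral>U\<^sub>x \<otimes> V\<^sub>y d\<gamma>\<close> (\<open>integral_ker_mult\<close>,
  \<open>integral_sqdist_mult\<close>). Since \<open>2 m\<^sub>\<mu>\<close> is the mean distance of two independent points,
  the distortion of \<open>\<gamma>\<close> equals \<open>E - 4\<integral>uv d\<gamma> - 8\<parallel>K\<parallel>\<^sup>2\<close>
  (\<open>distortion_eq\<close>).

  The concave term \<open>-8\<parallel>K\<parallel>\<^sup>2\<close> is linearised by completing a square: by Fubini,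
  \<open>\<integral>c\<^sub>a d\<gamma> = -4\<integral>uv d\<gamma> - 2\<langle>a, K\<rangle>\<close>, hence
  \<open>\<parallel>a\<parallel>\<^sup>2/8 + \<integral>c\<^sub>a d\<gamma>\<close> exceeds
  \<open>-4\<integral>uv d\<gamma> - 8\<parallel>K\<parallel>\<^sup>2\<close> by exactly \<open>\<parallel>a - 8K\<parallel>\<^sup>2/8\<close>
  (\<open>dual_objective_eq\<close>). The minimiser \<open>a = 8K\<close> lies in the prescribed ball because
  \<open>\<parallel>K\<parallel>\<^sup>2 \<le> m\<^sub>\<mu> m\<^sub>\<nu>\<close> by Cauchy--Schwarz (\<open>optimal_dual\<close>). Exchanging the two infima
  (\<open>INF_swap_attained\<close>) gives the theorem; a lower bound uniform in \<open>\<gamma>\<close>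
  (\<open>reduced_ge\<close>) ensures that all sets involved are bounded below.

  The expansion uses only that the features are centered, bounded and have
  square-integrable squared norms; it is carried out for two abstract feature maps on one
  probability space, which is then taken to be \<open>\<gamma>\<close>.
\<close>

section \<open>Rotation invariance of Lebesgue measure\<close>

lemma nn_integral_lborel_translate:
  fixes f :: "'a::euclidean_space \<Rightarrow> ennreal"
  assumes [measurable]: "f \<in> borel_measurable borel"
  shows "(\<integral>\<^sup>+x. f (x + c) \<partial>lborel) = (\<integral>\<^sup>+x. f x \<partial>lborel)"
proof -
  have "(\<integral>\<^sup>+x. f x \<partial>lborel) = (\<integral>\<^sup>+x. f x \<partial>distr lborel borel ((+) c))"
    by (simp add: lborel_distr_plus)
  also have "\<dots> = (\<integral>\<^sup>+x. f (c + x) \<partial>lborel)"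
    by (rule nn_integral_distr) auto
  finally show ?thesis by (simp add: add.commute)
qed

lemma nn_integral_lborel_reflect:
  fixes f :: "'a::euclidean_space \<Rightarrow> ennreal"
  assumes [measurable]: "f \<in> borel_measurable borel"
  shows "(\<integral>\<^sup>+x. f (c - x) \<partial>lborel) = (\<integral>\<^sup>+x. f x \<partial>lborel)"
proof -
  have "distr lborel borel (\<lambda>x. c - x) = lborel"
    using lborel_affine[of "-1" c] by (simp add: density_1 one_ereal_def[symmetric])
  then have "(\<integral>\<^sup>+x. f x \<partial>lborel) = (\<integral>\<^sup>+x. f x \<partial>distr lborel borel (\<lambda>x. c - x))"
    by simp
  also have "\<dots> = (\<integral>\<^sup>+x. f (c - x) \<partial>lborel)"
    by (rule nn_integral_distr) auto
  finally show ?thesis by simp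
qed

lemma emeasure_unit_ball:
  "emeasure lborel (ball (0::'a::euclidean_space) 1) \<noteq> \<infinity>"
  "emeasure lborel (ball (0::'a::euclidean_space) 1) \<noteq> 0"
  using emeasure_lborel_ball_finite[of "0::'a" 1] open_not_negligible[of "ball (0::'a) 1"]
  by (auto simp: negligible_iff_emeasure0 emeasure_completion)

text \<open>
  The image measure \<open>m\<close> of Lebesgue measure \<open>\<lambda>\<close> under \<open>T\<close> is translation invariant. For a
  translation invariant \<open>m\<close> the usual uniqueness argument for Haar measure applies: two
  translations, one reflection and Tonelli's theorem turn \<open>m(A) \<lambda>(B)\<close> into \<open>\<lambda>(A) m(B)\<close>, and an isometry
  preserves the unit ball \<open>B\<close>, so that \<open>m(B) = \<lambda>(B)\<close> cancels.
\<close>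
lemma lborel_distr_isometric_involution:
  fixes T :: "'a::euclidean_space \<Rightarrow> 'a"
  assumes lin: "linear T" and inv: "\<And>x. T (T x) = x" and iso: "\<And>x. norm (T x) = norm x"
  shows "distr lborel borel T = lborel"
proof (rule measure_eqI)
  have T[measurable]: "T \<in> borel_measurable borel"
    using lin by (intro borel_measurable_continuous_onI linear_continuous_on linear_conv_bounded_linear[THEN iffD1])
  fix A :: "'a set" assume "A \<in> sets (distr lborel borel T)"
  then have A[measurable]: "A \<in> sets borel" by simp
  let ?B = "ball (0::'a) 1"
  let ?L = "lborel :: 'a measure"
  have [measurable]: "?B \<in> sets borel" by simp
  have "emeasure (distr lborel borel T) A = (\<integral>\<^sup>+x. indicator A x \<partial>distr lborel borel T)"
    by simp
  also have "\<dots> = (\<integral>\<^sup>+x. indicator A (T x) \<partial>?L)"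
    by (rule nn_integral_distr) measurable
  finally have mA: "emeasure (distr lborel borel T) A = (\<integral>\<^sup>+x. indicator A (T x) \<partial>?L)" .
  have "emeasure (distr lborel borel T) A * emeasure ?L ?B =
      (\<integral>\<^sup>+x. \<integral>\<^sup>+y. indicator A (T x) * indicator ?B y \<partial>?L \<partial>?L)"
    by (simp add: nn_integral_cmult nn_integral_multc mA)
  also have "\<dots> = (\<integral>\<^sup>+x. \<integral>\<^sup>+y. indicator A (T x) * indicator ?B (y + T x) \<partial>?L \<partial>?L)"
    by (intro nn_integral_cong nn_integral_lborel_translate[symmetric]) measurable
  also have "\<dots> = (\<integral>\<^sup>+y. \<integral>\<^sup>+x. indicator A (T x) * indicator ?B (y + T x) \<partial>?L \<partial>?L)"
    by (rule lborel_pair.Fubini') measurable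
  \<comment> \<open>The shift is chosen such that \<open>T (x + T (- y)) = T x - y\<close>.\<close>
  also have "\<dots> = (\<integral>\<^sup>+y. \<integral>\<^sup>+x. indicator A (T (x + T (- y))) * indicator ?B (y + T (x + T (- y))) \<partial>?L \<partial>?L)"
    by (intro nn_integral_cong nn_integral_lborel_translate[symmetric]) measurable
  also have "\<dots> = (\<integral>\<^sup>+y. \<integral>\<^sup>+x. indicator A (T x - y) * indicator ?B x \<partial>?L \<partial>?L)"
    by (intro nn_integral_cong) (simp add: linear_add[OF lin] inv iso indicator_def)
  also have "\<dots> = (\<integral>\<^sup>+x. \<integral>\<^sup>+y. indicator A (T x - y) * indicator ?B x \<partial>?L \<partial>?L)"
    by (rule lborel_pair.Fubini') measurable
  also have "\<dots> = (\<integral>\<^sup>+x. \<integral>\<^sup>+y. indicator A y * indicator ?B x \<partial>?L \<partial>?L)"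
    by (intro nn_integral_cong nn_integral_lborel_reflect) measurable
  also have "\<dots> = emeasure ?L A * emeasure ?L ?B"
    by (simp add: nn_integral_cmult nn_integral_multc)
  finally show "emeasure (distr lborel borel T) A = emeasure lborel A"
    using emeasure_unit_ball[where 'a='a] by (simp add: ennreal_mult_cancel_left mult.commute[of _ "emeasure ?L ?B"])
qed simp

text \<open>
  The reflection in the hyperplane orthogonal to \<open>w\<close>, and the identity if \<open>w = 0\<close> (the
  quotient is then \<open>0\<close>). These reflections suffice below, since any two vectors of the same
  length are exchanged by one of them.
\<close>
definition householder :: "'a::euclidean_space \<Rightarrow> 'a \<Rightarrow> 'a" where
  "householder w z = z - (2 * (z \<bullet> w) / (w \<bullet> w)) *\<^sub>R w"

lemma linear_householder: "linear (householder w)"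
  unfolding householder_def
  by (rule linearI) (simp_all add: inner_add_left algebra_simps add_divide_distrib)

lemma householder_symmetric: "householder w x \<bullet> y = x \<bullet> householder w y"
  by (simp add: householder_def inner_diff_left inner_diff_right inner_commute)

lemma householder_involution: "householder w (householder w x) = x"
  by (cases "w = 0") (simp_all add: householder_def inner_diff_left algebra_simps)

lemma norm_householder: "norm (householder w x) = norm x"
  by (metis householder_symmetric householder_involution norm_eq_sqrt_inner)

lemma householder_swap:
  assumes "norm e = norm b"
  shows "householder (e - b) b = e"
proof (cases "e = b")
  case False
  have "e \<bullet> e = b \<bullet> b" using assms by (simp add: norm_eq_sqrt_inner)
  then have "(e - b) \<bullet> (e - b) = - 2 * (b \<bullet> (e - b))"
    by (simp add: inner_diff_left inner_diff_right inner_commute)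
  moreover have "(e - b) \<bullet> (e - b) \<noteq> 0" using False by simp
  ultimately have "2 * (b \<bullet> (e - b)) / ((e - b) \<bullet> (e - b)) = - 1"
    by (simp add: divide_eq_eq)
  then show ?thesis by (simp only: householder_def) simp
qed (simp add: householder_def)

section \<open>The uniform distribution on the sphere\<close>

lemma measurable_sgn [measurable]:
  "sgn \<in> borel_measurable (borel :: 'a::euclidean_space measure)"
  unfolding sgn_div_norm[abs_def] by measurable

lemma sphere_uniform_sets [measurable_cong, simp]:
  "sets (sphere_uniform :: 'a::euclidean_space measure) = sets (restrict_space borel (sphere 0 1))"
  by (simp add: sphere_uniform_def sets_restrict_space)

lemma space_sphere_uniform: "space (sphere_uniform :: 'a::euclidean_space measure) = sphere 0 1"
  by (simp add: sphere_uniform_def space_restrict_space)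

lemma measurable_sphere_uniform:
  "f \<in> measurable borel N \<Longrightarrow> f \<in> measurable (sphere_uniform :: 'a::euclidean_space measure) N"
  by (simp add: measurable_cong_sets[OF sphere_uniform_sets refl] measurable_restrict_space1)

text \<open>
  Integration over the sphere becomes integration over the ball, where the invariance of
  Lebesgue measure is available. The origin, whose direction is not on the sphere, is a
  null set.
\<close>
lemma nn_integral_sphere_uniform:
  fixes f :: "'a::euclidean_space \<Rightarrow> ennreal"
  assumes [measurable]: "f \<in> borel_measurable borel"
  shows "(\<integral>\<^sup>+\<theta>. f \<theta> \<partial>sphere_uniform) =
    (\<integral>\<^sup>+z. f (sgn z) * indicator (ball 0 1) z \<partial>lborel) / emeasure lborel (ball (0::'a) 1)"
proof -
  have [measurable]: "ball (0::'a) 1 \<in> sets borel" "sphere (0::'a) 1 \<in> sets borel"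
    by (simp_all add: borel_closed)
  have "(\<integral>\<^sup>+\<theta>. f \<theta> \<partial>sphere_uniform) =
    (\<integral>\<^sup>+z. f (sgn z) * indicator (sphere 0 1) (sgn z) \<partial>uniform_measure lborel (ball 0 1))"
    unfolding sphere_uniform_def
    by (subst nn_integral_restrict_space, simp add: borel_closed, rule nn_integral_distr)
      measurable
  also have "\<dots> = (\<integral>\<^sup>+z. f (sgn z) * indicator (sphere 0 1) (sgn z) * indicator (ball 0 1) z \<partial>lborel) / emeasure lborel (ball (0::'a) 1)"
    by (rule nn_integral_uniform_measure) measurable
  also have "(\<integral>\<^sup>+z. f (sgn z) * indicator (sphere 0 1) (sgn z) * indicator (ball 0 1) z \<partial>lborel) =
     (\<integral>\<^sup>+z. f (sgn z) * indicator (ball 0 1) z \<partial>lborel)"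
    by (intro nn_integral_cong_AE, rule AE_mp[OF AE_lborel_singleton[of 0]])
      (auto simp: norm_sgn indicator_def)
  finally show ?thesis .
qed

lemma prob_space_sphere_uniform: "prob_space (sphere_uniform :: 'a::euclidean_space measure)"
proof
  have "emeasure (sphere_uniform :: 'a measure) (space sphere_uniform) = (\<integral>\<^sup>+\<theta>. 1 \<partial>(sphere_uniform :: 'a measure))"
    by simp
  also have "\<dots> = 1"
    using emeasure_unit_ball[where 'a='a]
    by (subst nn_integral_sphere_uniform) (auto simp: top.not_eq_extremum)
  finally show "emeasure (sphere_uniform :: 'a measure) (space sphere_uniform) = 1" .
qed

text \<open>
  A reflection maps \<open>b\<close> to \<open>e\<close>; it is self-adjoint, commutes with \<open>sgn\<close> and preserves both
  the ball and Lebesgue measure.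
\<close>
lemma nn_integral_sphere_uniform_inner_eq:
  fixes e b :: "'a::euclidean_space"
  assumes "norm e = norm b"
  shows "(\<integral>\<^sup>+\<theta>. ennreal \<bar>\<theta> \<bullet> e\<bar> \<partial>sphere_uniform) = (\<integral>\<^sup>+\<theta>. ennreal \<bar>\<theta> \<bullet> b\<bar> \<partial>sphere_uniform)"
proof -
  let ?T = "householder (e - b)"
  have sgnT: "sgn (?T z) = ?T (sgn z)" for z
    using linear_householder[of "e - b"] by (simp add: sgn_div_norm norm_householder linear_scale)
  have T: "distr lborel borel ?T = lborel"
    by (intro lborel_distr_isometric_involution linear_householder householder_involution norm_householder)
  have [measurable]: "ball (0::'a) 1 \<in> sets borel" by simp
  have [measurable]: "?T \<in> borel_measurable borel"
    using linear_householder by (intro borel_measurable_continuous_onI linear_continuous_on linear_conv_bounded_linear[THEN iffD1])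
  have "(\<integral>\<^sup>+z. ennreal \<bar>sgn z \<bullet> b\<bar> * indicator (ball 0 1) z \<partial>lborel) =
     (\<integral>\<^sup>+z. ennreal \<bar>sgn z \<bullet> b\<bar> * indicator (ball 0 1) z \<partial>distr lborel borel ?T)"
    by (simp only: T)
  also have "\<dots> = (\<integral>\<^sup>+z. ennreal \<bar>sgn (?T z) \<bullet> b\<bar> * indicator (ball 0 1) (?T z) \<partial>lborel)"
    by (rule nn_integral_distr) measurable
  also have "\<dots> = (\<integral>\<^sup>+z. ennreal \<bar>sgn z \<bullet> e\<bar> * indicator (ball 0 1) z \<partial>lborel)"
    by (simp add: sgnT householder_symmetric householder_swap[OF assms] norm_householder indicator_def)
  finally show ?thesis by (simp add: nn_integral_sphere_uniform)
qed

lemma norm_some_Basis: "norm (SOME b. b \<in> (Basis :: 'a::euclidean_space set)) = 1"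
  by (rule norm_Basis) (use nonempty_Basis[where 'a='a] in \<open>simp add: some_in_eq\<close>)

lemma nn_integral_sphere_mean_abs:
  "(\<integral>\<^sup>+\<theta>. ennreal \<bar>(\<theta> :: 'a) \<bullet> (SOME b. b \<in> Basis)\<bar> \<partial>sphere_uniform) =
    ennreal (sphere_mean_abs TYPE('a::euclidean_space))"
proof -
  interpret prob_space "sphere_uniform :: 'a measure" by (rule prob_space_sphere_uniform)
  note b = norm_some_Basis[where 'a='a]
  have "integrable sphere_uniform (\<lambda>\<theta>. \<bar>(\<theta> :: 'a) \<bullet> (SOME b. b \<in> Basis)\<bar>)"
  proof (rule integrable_const_bound[where B = 1])
    show "AE \<theta> in sphere_uniform. norm \<bar>(\<theta> :: 'a) \<bullet> (SOME b. b \<in> Basis)\<bar> \<le> 1"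
    proof (rule AE_I2)
      fix \<theta> :: 'a assume "\<theta> \<in> space sphere_uniform"
      then show "norm \<bar>\<theta> \<bullet> (SOME b. b \<in> Basis)\<bar> \<le> 1"
        using Cauchy_Schwarz_ineq2[of \<theta> "SOME b. b \<in> Basis"] b by (simp add: space_sphere_uniform)
    qed
  qed (rule measurable_sphere_uniform, measurable)
  then show ?thesis unfolding sphere_mean_abs_def
    by (rule nn_integral_eq_integral) simp
qed

text \<open>
  By the previous invariance all basis vectors give the same mean, and the coordinates of a
  unit vector satisfy \<open>1 \<le> \<Sum>|\<theta>\<^sub>i|\<close>; so the mean is at least \<open>1/d\<close>. Positivity
  matters because the half-space measure is scaled by the inverse of this constant.
\<close>
lemma sphere_mean_abs_pos: "sphere_mean_abs TYPE('a::euclidean_space) > 0"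
proof -
  interpret prob_space "sphere_uniform :: 'a measure" by (rule prob_space_sphere_uniform)
  note b = norm_some_Basis[where 'a='a]
  have [measurable]: "(\<lambda>\<theta>. \<bar>\<theta> \<bullet> i\<bar>) \<in> borel_measurable sphere_uniform" for i :: 'a
    by (rule measurable_sphere_uniform) measurable
  have "1 = (\<integral>\<^sup>+\<theta>. 1 \<partial>(sphere_uniform :: 'a measure))"
    by (simp add: emeasure_space_1)
  also have "\<dots> \<le> (\<integral>\<^sup>+\<theta>. (\<Sum>i\<in>Basis. ennreal \<bar>\<theta> \<bullet> i\<bar>) \<partial>(sphere_uniform :: 'a measure))"
  proof (rule nn_integral_mono)
    fix \<theta> :: 'a assume "\<theta> \<in> space sphere_uniform"
    then show "1 \<le> (\<Sum>i\<in>Basis. ennreal \<bar>\<theta> \<bullet> i\<bar>)"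
      using norm_le_l1[of \<theta>] by (simp add: space_sphere_uniform)
  qed
  also have "\<dots> = (\<Sum>i\<in>Basis. \<integral>\<^sup>+\<theta>. ennreal \<bar>\<theta> \<bullet> i\<bar> \<partial>(sphere_uniform :: 'a measure))"
    by (rule nn_integral_sum) simp
  also have "\<dots> = (\<Sum>i\<in>(Basis :: 'a set). ennreal (sphere_mean_abs TYPE('a)))"
  proof (rule sum.cong)
    fix i :: 'a assume "i \<in> Basis"
    then show "(\<integral>\<^sup>+\<theta>. ennreal \<bar>\<theta> \<bullet> i\<bar> \<partial>sphere_uniform) = ennreal (sphere_mean_abs TYPE('a))"
      using nn_integral_sphere_uniform_inner_eq[of i "SOME b. b \<in> Basis"] b
      by (simp add: nn_integral_sphere_mean_abs)
  qed simp
  finally show ?thesis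
    by (rule contrapos_pp) (simp add: ennreal_neg)
qed

lemma nn_integral_sphere_uniform_inner:
  fixes x :: "'a::euclidean_space"
  shows "(\<integral>\<^sup>+\<theta>. ennreal \<bar>\<theta> \<bullet> x\<bar> \<partial>sphere_uniform) = ennreal (sphere_mean_abs TYPE('a) * norm x)"
proof -
  let ?b = "SOME b. b \<in> (Basis :: 'a set)"
  note b = norm_some_Basis[where 'a='a]
  have [measurable]: "(\<lambda>\<theta>. \<bar>\<theta> \<bullet> i\<bar>) \<in> borel_measurable sphere_uniform" for i :: 'a
    by (rule measurable_sphere_uniform) measurable
  have "(\<integral>\<^sup>+\<theta>. ennreal \<bar>\<theta> \<bullet> x\<bar> \<partial>sphere_uniform) = (\<integral>\<^sup>+\<theta>. ennreal \<bar>\<theta> \<bullet> (norm x *\<^sub>R ?b)\<bar> \<partial>sphere_uniform)"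
    by (rule nn_integral_sphere_uniform_inner_eq) (simp add: b)
  also have "\<dots> = (\<integral>\<^sup>+\<theta>. ennreal (norm x) * ennreal \<bar>\<theta> \<bullet> ?b\<bar> \<partial>sphere_uniform)"
    by (simp add: abs_mult ennreal_mult')
  also have "\<dots> = ennreal (norm x) * ennreal (sphere_mean_abs TYPE('a))"
    by (subst nn_integral_cmult) (simp_all add: nn_integral_sphere_mean_abs)
  finally show ?thesis using sphere_mean_abs_pos[where 'a='a] by (simp add: ennreal_mult' mult.commute)
qed

section \<open>The half-space measure\<close>

lemma sigma_finite_scale_measure:
  assumes "sigma_finite_measure M" "c \<noteq> \<top>"
  shows "sigma_finite_measure (scale_measure c M)"
proof -
  interpret sigma_finite_measure M by fact
  have "scale_measure c M = density M (\<lambda>_. c)"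
    by (rule measure_eqI) (simp_all add: emeasure_density_const)
  then show ?thesis
    using assms by (simp add: sigma_finite_iff_density_finite)
qed

lemma sigma_finite_half_space_measure:
  "sigma_finite_measure (half_space_measure :: ('a::euclidean_space \<times> real) measure)"
proof -
  interpret S: prob_space "sphere_uniform :: 'a measure" by (rule prob_space_sphere_uniform)
  interpret P: pair_sigma_finite "sphere_uniform :: 'a measure" "lborel :: real measure" ..
  show ?thesis unfolding half_space_measure_def
    by (rule sigma_finite_scale_measure) (simp_all add: P.sigma_finite_measure_axioms)
qed

text \<open>
  The half-space measure lives on \<open>sphere 0 1 \<times> UNIV\<close>, where the sphere carries the trace of
  the Borel sets; Borel functions on the whole space restrict to it.
\<close>
lemma measurable_half_space_measure:
  assumes "f \<in> measurable (borel \<Otimes>\<^sub>M borel) N"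
  shows "f \<in> measurable half_space_measure N"
proof -
  have "(\<lambda>p. (fst p, snd p)) \<in> measurable (half_space_measure :: ('a \<times> real) measure) (borel \<Otimes>\<^sub>M borel)"
    unfolding half_space_measure_def
    by (intro measurable_Pair)
      (simp_all add: measurable_cong_sets[OF sets_scale_measure refl] measurable_compose[OF measurable_fst measurable_sphere_uniform[of "\<lambda>x. x"]])
  from measurable_compose[OF this assms] show ?thesis by simp
qed

text \<open>
  The Crofton formula. For a fixed direction \<open>\<theta>\<close> the half-spaces that separate \<open>x\<close> from \<open>y\<close>
  have offsets in an interval of length \<open>|\<theta> \<bullet> (x - y)|\<close>; averaging over \<open>\<theta>\<close> gives the norm
  of \<open>x - y\<close> up to the constant that the scaling of the measure removes.
\<close>
lemma half_space_crofton:
  fixes x y :: "'a::euclidean_space"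
  shows "(\<integral>\<^sup>+\<xi>. ennreal ((indicat_real (half_space \<xi>) x - indicat_real (half_space \<xi>) y)\<^sup>2) \<partial>half_space_measure) = ennreal (norm (x - y))"
proof -
  let ?S = "sphere_uniform :: 'a measure"
  define f where "f = (\<lambda>\<xi>. (indicat_real (half_space \<xi>) x - indicat_real (half_space \<xi>) y)\<^sup>2)"
  have f: "f \<in> borel_measurable (borel \<Otimes>\<^sub>M borel)"
    unfolding f_def half_space_def indicator_def by measurable
  have [measurable]: "f \<in> borel_measurable (?S \<Otimes>\<^sub>M lborel)"
    using measurable_half_space_measure[OF f]
    by (simp add: half_space_measure_def measurable_cong_sets[OF sets_scale_measure refl])
  have [measurable]: "(\<lambda>\<theta>. \<bar>\<theta> \<bullet> i\<bar>) \<in> borel_measurable sphere_uniform" for i :: 'a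
    by (rule measurable_sphere_uniform) measurable
  have inner: "(\<integral>\<^sup>+t. ennreal (f (\<theta>, t)) \<partial>lborel) = ennreal \<bar>\<theta> \<bullet> (x - y)\<bar>" for \<theta>
  proof -
    \<comment> \<open>The right end is open and the left end closed since half-spaces are open: \<open>\<theta> \<bullet> x > t\<close>.\<close>
    have "(\<integral>\<^sup>+t. ennreal (f (\<theta>, t)) \<partial>lborel) =
        (\<integral>\<^sup>+t. indicator {min (\<theta> \<bullet> x) (\<theta> \<bullet> y)..<max (\<theta> \<bullet> x) (\<theta> \<bullet> y)} t \<partial>lborel)"
      by (intro nn_integral_cong) (auto simp: f_def half_space_def indicator_def)
    also have "\<dots> = ennreal \<bar>\<theta> \<bullet> (x - y)\<bar>"
      by (simp add: inner_diff_right abs_real_def min_def max_def)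
    finally show ?thesis .
  qed
  have "(\<integral>\<^sup>+\<xi>. ennreal (f \<xi>) \<partial>half_space_measure) =
      ennreal (1 / sphere_mean_abs TYPE('a)) * (\<integral>\<^sup>+\<theta>. (\<integral>\<^sup>+t. ennreal (f (\<theta>, t)) \<partial>lborel) \<partial>?S)"
    unfolding half_space_measure_def
    by (subst nn_integral_scale_measure, simp, subst lborel.nn_integral_fst[symmetric], simp_all)
  also have "\<dots> = ennreal (1 / sphere_mean_abs TYPE('a)) * ennreal (sphere_mean_abs TYPE('a) * norm (x - y))"
    by (simp only: inner nn_integral_sphere_uniform_inner)
  also have "\<dots> = ennreal (norm (x - y))"
    using sphere_mean_abs_pos[where 'a='a] by (simp flip: ennreal_mult')
  finally show ?thesis by (simp add: f_def)
qed

section \<open>Auxiliary facts on integrals and infima\<close>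

lemma (in pair_sigma_finite) integrable_tensor:
  fixes \<phi> :: "'a \<Rightarrow> real" and \<psi> :: "'b \<Rightarrow> real"
  assumes \<phi>: "integrable M1 \<phi>" and \<psi>: "integrable M2 \<psi>"
  shows "integrable (M1 \<Otimes>\<^sub>M M2) (\<lambda>w. \<phi> (fst w) * \<psi> (snd w))"
    and "(\<integral>w. \<phi> (fst w) * \<psi> (snd w) \<partial>(M1 \<Otimes>\<^sub>M M2)) = (\<integral>x. \<phi> x \<partial>M1) * (\<integral>y. \<psi> y \<partial>M2)"
proof -
  have [measurable]: "\<phi> \<in> borel_measurable M1" "\<psi> \<in> borel_measurable M2"
    using \<phi> \<psi> by auto
  show int: "integrable (M1 \<Otimes>\<^sub>M M2) (\<lambda>w. \<phi> (fst w) * \<psi> (snd w))"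
  proof (rule Fubini_integrable)
    show "integrable M1 (\<lambda>x. \<integral>y. norm (\<phi> (fst (x, y)) * \<psi> (snd (x, y))) \<partial>M2)"
      using \<phi> by (simp add: abs_mult)
  qed (use \<psi> in simp_all)
  show "(\<integral>w. \<phi> (fst w) * \<psi> (snd w) \<partial>(M1 \<Otimes>\<^sub>M M2)) = (\<integral>x. \<phi> x \<partial>M1) * (\<integral>y. \<psi> y \<partial>M2)"
    using integral_fst'[OF int] by simp
qed

lemma (in sigma_finite_measure) nn_integral_tensor:
  assumes [measurable]: "\<phi> \<in> borel_measurable N" "\<psi> \<in> borel_measurable M"
  shows "(\<integral>\<^sup>+w. \<phi> (fst w) * \<psi> (snd w) \<partial>(N \<Otimes>\<^sub>M M)) = (\<integral>\<^sup>+x. \<phi> x \<partial>N) * (\<integral>\<^sup>+y. \<psi> y \<partial>M)"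
  by (subst nn_integral_fst[symmetric]) (simp_all add: nn_integral_cmult nn_integral_multc)

lemma abs_mult_le_sum_squares: "\<bar>a * b\<bar> \<le> a\<^sup>2 + (b::real)\<^sup>2"
proof -
  have "2 * (\<bar>a\<bar> * \<bar>b\<bar>) \<le> \<bar>a\<bar>\<^sup>2 + \<bar>b\<bar>\<^sup>2"
    using sum_squares_bound[of "\<bar>a\<bar>" "\<bar>b\<bar>"] by simp
  moreover have "0 \<le> \<bar>a\<bar> * \<bar>b\<bar>" by simp
  ultimately show ?thesis
    unfolding abs_mult power2_abs by linarith
qed

lemma integrable_mult_of_squares:
  fixes a b :: "'a \<Rightarrow> real"
  assumes [measurable]: "a \<in> borel_measurable M" "b \<in> borel_measurable M"
    and "integrable M (\<lambda>x. (a x)\<^sup>2)" "integrable M (\<lambda>x. (b x)\<^sup>2)"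
  shows "integrable M (\<lambda>x. a x * b x)"
proof (rule Bochner_Integration.integrable_bound[where f = "\<lambda>x. (a x)\<^sup>2 + (b x)\<^sup>2"])
  show "AE x in M. norm (a x * b x) \<le> norm ((a x)\<^sup>2 + (b x)\<^sup>2)"
    using abs_mult_le_sum_squares[of "a _" "b _"] by (intro AE_I2) (simp add: abs_of_nonneg)
qed (use assms in simp_all)

lemma integrable_square_add:
  fixes a b :: "'a \<Rightarrow> real"
  assumes [measurable]: "a \<in> borel_measurable M" "b \<in> borel_measurable M"
    and "integrable M (\<lambda>x. (a x)\<^sup>2)" "integrable M (\<lambda>x. (b x)\<^sup>2)"
  shows "integrable M (\<lambda>x. (a x + b x)\<^sup>2)"
  using assms integrable_mult_of_squares[OF assms]
  by (simp add: power2_sum mult.assoc)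

lemma (in prob_space) expectation_square_le:
  fixes X :: "'a \<Rightarrow> real"
  assumes [measurable]: "X \<in> borel_measurable M" and X2: "integrable M (\<lambda>x. (X x)\<^sup>2)"
  shows "(expectation X)\<^sup>2 \<le> expectation (\<lambda>x. (X x)\<^sup>2)"
  using variance_positive[of X] variance_eq[OF square_integrable_imp_integrable[OF assms] X2] by simp

text \<open>
  Exchange of infima for an objective \<open>q a + p a c\<close> whose partial infimum over \<open>a\<close> is attained
  at \<open>m c\<close> with value \<open>J c\<close>. In the reals, infima are meaningful only for nonempty sets
  bounded below; the bound \<open>L\<close> on \<open>J\<close> bounds all of them.
\<close>
lemma INF_swap_attained:
  fixes q :: "'a \<Rightarrow> real" and p :: "'a \<Rightarrow> 'b \<Rightarrow> real"
  assumes "C \<noteq> {}"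
    and attained: "\<And>c. c \<in> C \<Longrightarrow> m c \<in> A \<and> q (m c) + p (m c) c = J c"
    and minimal: "\<And>a c. a \<in> A \<Longrightarrow> c \<in> C \<Longrightarrow> J c \<le> q a + p a c"
    and lower: "\<And>c. c \<in> C \<Longrightarrow> L \<le> J c"
  shows "(INF c\<in>C. e + J c) = e + (INF a\<in>A. q a + (INF c\<in>C. p a c))"
proof (rule antisym)
  have A: "A \<noteq> {}" using assms by blast
  have bdd_p: "bdd_below (p a ` C)" if "a \<in> A" for a
    using minimal[OF that] lower by (intro bdd_belowI2[of _ "L - q a"]) (force simp: algebra_simps)
  have bdd_J: "bdd_below ((\<lambda>c. e + J c) ` C)"
    using lower by (intro bdd_belowI2[of _ "e + L"]) simp
  have *: "(INF c\<in>C. e + J c) \<le> e + (q a + (INF c\<in>C. p a c))" if a: "a \<in> A" for a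
  proof -
    have "(INF c\<in>C. e + J c) - e - q a \<le> (INF c\<in>C. p a c)"
    proof (rule cINF_greatest[OF \<open>C \<noteq> {}\<close>])
      fix c assume c: "c \<in> C"
      then show "(INF c\<in>C. e + J c) - e - q a \<le> p a c"
        using cINF_lower[OF bdd_J c] minimal[OF a c] by simp
    qed
    then show ?thesis by simp
  qed
  have "(INF c\<in>C. e + J c) - e \<le> (INF a\<in>A. q a + (INF c\<in>C. p a c))"
    using * by (intro cINF_greatest[OF A]) (simp add: algebra_simps)
  then show "(INF c\<in>C. e + J c) \<le> e + (INF a\<in>A. q a + (INF c\<in>C. p a c))" by simp
  have bdd_A: "bdd_below ((\<lambda>a. q a + (INF c\<in>C. p a c)) ` A)"
    using * by (intro bdd_belowI2[of _ "(INF c\<in>C. e + J c) - e"]) (simp add: algebra_simps)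
  show "e + (INF a\<in>A. q a + (INF c\<in>C. p a c)) \<le> (INF c\<in>C. e + J c)"
  proof (rule cINF_greatest[OF \<open>C \<noteq> {}\<close>])
    fix c assume c: "c \<in> C"
    then have m: "m c \<in> A" "q (m c) + p (m c) c = J c" using attained by auto
    have "(INF a\<in>A. q a + (INF c\<in>C. p a c)) \<le> q (m c) + (INF c'\<in>C. p (m c) c')"
      using cINF_lower[OF bdd_A m(1)] by simp
    also have "\<dots> \<le> J c"
      using cINF_lower[OF bdd_p[OF m(1)] c] m(2) by simp
    finally show "e + (INF a\<in>A. q a + (INF c\<in>C. p a c)) \<le> e + J c" by simp
  qed
qed

section \<open>Centered square-integrable features\<close>

text \<open>
  A feature map assigns to a point \<open>z\<close> of a probability space the function \<open>f z\<close> in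
  \<open>L\<^sup>2(P)\<close>. It is bounded and has mean zero pointwise on \<open>P\<close>, so that means over \<open>z\<close> are ordinary
  integrals and no integration of Hilbert space valued functions is involved. The last
  assumption, a fourth moment of the norm of \<open>f z\<close>, makes all products below integrable.
\<close>
locale centered_features = G: prob_space G + P: sigma_finite_measure P
  for G :: "'z measure" and P :: "'p measure" +
  fixes f :: "'z \<Rightarrow> 'p \<Rightarrow> real"
  assumes measurable_feature: "case_prod f \<in> borel_measurable (G \<Otimes>\<^sub>M P)"
    and feature_bounded: "\<And>z p. \<bar>f z p\<bar> \<le> 1"
    and feature_mean: "\<And>p. p \<in> space P \<Longrightarrow> (\<integral>z. f z p \<partial>G) = 0"
    and feature_L2: "\<And>z. z \<in> space G \<Longrightarrow> integrable P (\<lambda>p. (f z p)\<^sup>2)"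
    and norm_sq_L2: "integrable G (\<lambda>z. (\<integral>p. (f z p)\<^sup>2 \<partial>P)\<^sup>2)"
begin

definition nsq :: "'z \<Rightarrow> real" where "nsq z = (\<integral>p. (f z p)\<^sup>2 \<partial>P)"
definition ker :: "'z \<Rightarrow> 'z \<Rightarrow> real" where "ker z z' = (\<integral>p. f z p * f z' p \<partial>P)"
definition sqdist :: "'z \<Rightarrow> 'z \<Rightarrow> real" where "sqdist z z' = (\<integral>p. (f z p - f z' p)\<^sup>2 \<partial>P)"

sublocale GG: pair_prob_space G G ..
sublocale GP: pair_sigma_finite G P ..

lemma measurable_feature_at [measurable (raw)]:
  assumes "g \<in> measurable N G" "h \<in> measurable N P"
  shows "(\<lambda>x. f (g x) (h x)) \<in> borel_measurable N"
  using measurable_compose[OF measurable_Pair[OF assms] measurable_feature] by simp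

lemma measurable_nsq [measurable]: "nsq \<in> borel_measurable G"
  unfolding nsq_def[abs_def] by measurable

lemma measurable_ker [measurable (raw)]:
  assumes [measurable]: "g \<in> measurable N G" "h \<in> measurable N G"
  shows "(\<lambda>x. ker (g x) (h x)) \<in> borel_measurable N"
  unfolding ker_def by measurable

lemma nsq_nonneg: "0 \<le> nsq z"
  by (simp add: nsq_def)

lemma integrable_nsq: "integrable G nsq" "integrable G (\<lambda>z. (nsq z)\<^sup>2)"
proof -
  show "integrable G (\<lambda>z. (nsq z)\<^sup>2)" using norm_sq_L2 by (simp add: nsq_def)
  then show "integrable G nsq" by (rule G.square_integrable_imp_integrable[rotated]) simp
qed

lemma integrable_feature_mult:
  "z \<in> space G \<Longrightarrow> z' \<in> space G \<Longrightarrow> integrable P (\<lambda>p. f z p * f z' p)"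
  by (intro integrable_mult_of_squares feature_L2) measurable

lemma ker_commute: "ker z z' = ker z' z"
  by (simp add: ker_def mult.commute)

lemma sqdist_eq:
  assumes "z \<in> space G" "z' \<in> space G"
  shows "sqdist z z' = nsq z + nsq z' - 2 * ker z z'"
proof -
  note int = feature_L2[OF assms(1)] feature_L2[OF assms(2)] integrable_feature_mult[OF assms]
  have "sqdist z z' = (\<integral>p. (f z p)\<^sup>2 + (f z' p)\<^sup>2 - 2 * (f z p * f z' p) \<partial>P)"
    by (simp add: sqdist_def power2_diff mult.assoc)
  then show ?thesis
    using int by (simp add: nsq_def ker_def)
qed

lemma abs_ker_le:
  assumes "z \<in> space G" "z' \<in> space G"
  shows "\<bar>ker z z'\<bar> \<le> nsq z + nsq z'"
proof -
  have "\<bar>ker z z'\<bar> \<le> (\<integral>p. \<bar>f z p * f z' p\<bar> \<partial>P)"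
    unfolding ker_def by (rule integral_abs_bound)
  also have "\<dots> \<le> (\<integral>p. (f z p)\<^sup>2 + (f z' p)\<^sup>2 \<partial>P)"
    using feature_L2[OF assms(1)] feature_L2[OF assms(2)] integrable_feature_mult[OF assms]
    by (intro integral_mono abs_mult_le_sum_squares) simp_all
  also have "\<dots> = nsq z + nsq z'"
    using feature_L2[OF assms(1)] feature_L2[OF assms(2)] by (simp add: nsq_def)
  finally show ?thesis .
qed

text \<open>
  The inner product with \<open>f z\<close> is linear and \<open>f\<close> has mean zero. This is what cancels the
  mixed terms later on.
\<close>
lemma integral_ker:
  assumes z: "z \<in> space G"
  shows "(\<integral>z'. ker z z' \<partial>G) = 0"
proof -
  have [measurable]: "(\<lambda>_. z) \<in> measurable N G" for N :: "('z \<times> 'p) measure"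
    using z by simp
  have "integrable (G \<Otimes>\<^sub>M P) (\<lambda>w. f z (snd w) * f (fst w) (snd w))"
  proof (rule integrable_mult_of_squares)
    show "integrable (G \<Otimes>\<^sub>M P) (\<lambda>w. (f z (snd w))\<^sup>2)"
      using GP.integrable_tensor(1)[of "\<lambda>_. 1" "\<lambda>p. (f z p)\<^sup>2"] feature_L2[OF z] by simp
    show "integrable (G \<Otimes>\<^sub>M P) (\<lambda>w. (f (fst w) (snd w))\<^sup>2)"
    proof (rule GP.Fubini_integrable)
      show "integrable G (\<lambda>z. \<integral>p. norm ((f (fst (z, p)) (snd (z, p)))\<^sup>2) \<partial>P)"
        using integrable_nsq(1) by (simp add: nsq_def[abs_def])
      show "AE z in G. integrable P (\<lambda>p. (f (fst (z, p)) (snd (z, p)))\<^sup>2)"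
        using feature_L2 by (intro AE_I2) simp
    qed measurable
  qed measurable
  then have int: "integrable (G \<Otimes>\<^sub>M P) (\<lambda>(z', p). f z p * f z' p)"
    by (simp add: split_beta')
  have "(\<integral>z'. ker z z' \<partial>G) = (\<integral>p. \<integral>z'. f z p * f z' p \<partial>G \<partial>P)"
    unfolding ker_def using GP.Fubini_integral[OF int] by simp
  also have "\<dots> = (\<integral>p. 0 \<partial>P)"
    by (intro Bochner_Integration.integral_cong) (simp_all add: feature_mean)
  finally show ?thesis by simp
qed

lemma GG_integrable:
  assumes "integrable G (h :: 'z \<Rightarrow> real)"
  shows "integrable (G \<Otimes>\<^sub>M G) (\<lambda>w. h (fst w))" "integrable (G \<Otimes>\<^sub>M G) (\<lambda>w. h (snd w))"
    "(\<integral>w. h (fst w) \<partial>(G \<Otimes>\<^sub>M G)) = (\<integral>z. h z \<partial>G)" "(\<integral>w. h (snd w) \<partial>(G \<Otimes>\<^sub>M G)) = (\<integral>z. h z \<partial>G)"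
  using GG.integrable_tensor[OF assms G.integrable_const[of 1]] GG.integrable_tensor[OF G.integrable_const[of 1] assms]
  by (simp_all add: G.prob_space)

lemma ker_L2: "integrable (G \<Otimes>\<^sub>M G) (\<lambda>w. (ker (fst w) (snd w))\<^sup>2)"
proof (rule Bochner_Integration.integrable_bound[where f = "\<lambda>w. (nsq (fst w) + nsq (snd w))\<^sup>2"])
  show "integrable (G \<Otimes>\<^sub>M G) (\<lambda>w. (nsq (fst w) + nsq (snd w))\<^sup>2)"
    by (intro integrable_square_add) (use GG_integrable[OF integrable_nsq(2)] in simp_all)
  show "AE w in G \<Otimes>\<^sub>M G. norm ((ker (fst w) (snd w))\<^sup>2) \<le> norm ((nsq (fst w) + nsq (snd w))\<^sup>2)"
  proof (rule AE_I2)
    fix w assume "w \<in> space (G \<Otimes>\<^sub>M G)"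
    then have "\<bar>ker (fst w) (snd w)\<bar> \<le> \<bar>nsq (fst w) + nsq (snd w)\<bar>"
      using abs_ker_le[of "fst w" "snd w"] nsq_nonneg[of "fst w"] nsq_nonneg[of "snd w"]
      by (auto simp: space_pair_measure)
    then show "norm ((ker (fst w) (snd w))\<^sup>2) \<le> norm ((nsq (fst w) + nsq (snd w))\<^sup>2)"
      by (simp add: abs_le_square_iff)
  qed
qed measurable

text \<open>
  Integrate first over the variable on which \<open>h\<close> does not depend; the kernel is symmetric, so
  it may be either of the two.
\<close>
lemma integral_mult_ker:
  assumes h[measurable]: "h \<in> borel_measurable G" and h2: "integrable G (\<lambda>z. (h z :: real)\<^sup>2)"
  shows "integrable (G \<Otimes>\<^sub>M G) (\<lambda>v. h (fst v) * ker (fst v) (snd v))"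
    and "integrable (G \<Otimes>\<^sub>M G) (\<lambda>v. h (snd v) * ker (fst v) (snd v))"
    and "(\<integral>v. h (fst v) * ker (fst v) (snd v) \<partial>(G \<Otimes>\<^sub>M G)) = 0"
    and "(\<integral>v. h (snd v) * ker (fst v) (snd v) \<partial>(G \<Otimes>\<^sub>M G)) = 0"
proof -
  show 1: "integrable (G \<Otimes>\<^sub>M G) (\<lambda>v. h (fst v) * ker (fst v) (snd v))"
    by (intro integrable_mult_of_squares ker_L2 GG_integrable h2) measurable
  show 2: "integrable (G \<Otimes>\<^sub>M G) (\<lambda>v. h (snd v) * ker (fst v) (snd v))"
    by (intro integrable_mult_of_squares ker_L2 GG_integrable h2) measurable
  have "(\<integral>z. h z * (\<integral>z'. ker z z' \<partial>G) \<partial>G) = (\<integral>z. 0 \<partial>G)"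
    by (intro Bochner_Integration.integral_cong) (simp_all add: integral_ker)
  then show "(\<integral>v. h (fst v) * ker (fst v) (snd v) \<partial>(G \<Otimes>\<^sub>M G)) = 0"
    using GG.integral_fst'[OF 1] by simp
  have 3: "integrable (G \<Otimes>\<^sub>M G) (\<lambda>(z, z'). h z' * ker z z')"
    using 2 by (simp add: split_beta')
  have "(\<integral>z'. \<integral>z. h z' * ker z z' \<partial>G \<partial>G) = (\<integral>z'. 0 \<partial>G)"
  proof (intro Bochner_Integration.integral_cong refl)
    fix z' assume "z' \<in> space G"
    then show "(\<integral>z. h z' * ker z z' \<partial>G) = 0"
      using integral_ker[of z'] by (simp add: ker_commute[of _ z'])
  qed
  then show "(\<integral>v. h (snd v) * ker (fst v) (snd v) \<partial>(G \<Otimes>\<^sub>M G)) = 0"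
    using GG.integral_snd[OF 3] by (simp add: split_beta')
qed

lemma sqdist_L2: "integrable (G \<Otimes>\<^sub>M G) (\<lambda>v. (sqdist (fst v) (snd v))\<^sup>2)"
proof -
  have eq: "(sqdist (fst v) (snd v))\<^sup>2 = ((nsq (fst v) + nsq (snd v)) + (- 2) * ker (fst v) (snd v))\<^sup>2"
    if "v \<in> space (G \<Otimes>\<^sub>M G)" for v
    using that by (auto simp: space_pair_measure sqdist_eq)
  have "integrable (G \<Otimes>\<^sub>M G) (\<lambda>v. ((nsq (fst v) + nsq (snd v)) + (- 2) * ker (fst v) (snd v))\<^sup>2)"
    using ker_L2 by (intro integrable_square_add GG_integrable integrable_nsq) (simp_all add: power_mult_distrib)
  then show ?thesis
    by (subst Bochner_Integration.integrable_cong[OF refl eq])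
qed

lemma integrable_sqdist: "integrable (G \<Otimes>\<^sub>M G) (\<lambda>v. sqdist (fst v) (snd v))"
proof -
  have "(\<lambda>v. sqdist (fst v) (snd v)) \<in> borel_measurable (G \<Otimes>\<^sub>M G)"
    unfolding sqdist_def by measurable
  then show ?thesis
    by (rule GG.P.square_integrable_imp_integrable[OF _ sqdist_L2])
qed

lemma integral_sqdist: "(\<integral>v. sqdist (fst v) (snd v) \<partial>(G \<Otimes>\<^sub>M G)) = 2 * (\<integral>z. nsq z \<partial>G)"
proof -
  \<comment> \<open>The factor \<open>1\<close> gives the kernel the form that \<open>integral_mult_ker\<close> expects.\<close>
  have eq: "sqdist (fst v) (snd v) = nsq (fst v) + nsq (snd v) - 2 * (1 * ker (fst v) (snd v))"
    if "v \<in> space (G \<Otimes>\<^sub>M G)" for v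
    using that by (auto simp: space_pair_measure sqdist_eq)
  show ?thesis
    using GG_integrable[OF integrable_nsq(1)] integral_mult_ker[of "\<lambda>_. 1"]
    by (subst Bochner_Integration.integral_cong[OF refl eq]) simp_all
qed

end

section \<open>A pair of centered features over one probability space\<close>

locale centered_feature_pair =
  F: centered_features G P f + H: centered_features G Q g
  for G :: "'z measure" and P :: "'p measure" and Q :: "'q measure"
    and f :: "'z \<Rightarrow> 'p \<Rightarrow> real" and g :: "'z \<Rightarrow> 'q \<Rightarrow> real"
begin

text \<open>
  The cross moment \<open>\<integral>f\<^sub>z \<otimes> g\<^sub>z dG\<close>, computed pointwise.
\<close>
definition cross :: "'p \<times> 'q \<Rightarrow> real" where
  "cross w = (\<integral>z. f z (fst w) * g z (snd w) \<partial>G)"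

sublocale PQ: pair_sigma_finite P Q ..

lemma sigma_finite_PQ: "sigma_finite_measure (P \<Otimes>\<^sub>M Q)"
  by (rule PQ.sigma_finite_measure_axioms)

sublocale GPQ: pair_sigma_finite G "P \<Otimes>\<^sub>M Q"
  by (intro pair_sigma_finite.intro F.G.sigma_finite_measure_axioms sigma_finite_PQ)

sublocale GGPQ: pair_sigma_finite "G \<Otimes>\<^sub>M G" "P \<Otimes>\<^sub>M Q"
  by (intro pair_sigma_finite.intro F.GG.sigma_finite_measure_axioms sigma_finite_PQ)

lemma measurable_cross [measurable]: "cross \<in> borel_measurable (P \<Otimes>\<^sub>M Q)"
  unfolding cross_def[abs_def] by measurable

text \<open>
  Cauchy--Schwarz over \<open>G\<close> at each fixed pair \<open>(p, q)\<close> separates the variables: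
  \<open>K(p, q)\<^sup>2 \<le> (\<integral>f\<^sub>z(p)\<^sup>2 dG) (\<integral>g\<^sub>z(q)\<^sup>2 dG)\<close>, and the integral of the
  right-hand side factorises into the product of the mean squared norms. Jensen's inequality, which bounds
  \<open>K\<^sup>2\<close> by the mean of \<open>f\<^sub>z(p)\<^sup>2 g\<^sub>z(q)\<^sup>2\<close>, would instead give the mean of the product of
  the squared norms, a quantity that depends on the joint law.
\<close>
lemma nn_integral_cross_sq_le:
  "(\<integral>\<^sup>+w. ennreal ((cross w)\<^sup>2) \<partial>(P \<Otimes>\<^sub>M Q)) \<le> ennreal ((\<integral>z. F.nsq z \<partial>G) * (\<integral>z. H.nsq z \<partial>G))"
proof -
  have swap: "(\<integral>\<^sup>+p. \<integral>\<^sup>+z. ennreal ((h z p)\<^sup>2) \<partial>G \<partial>R) = ennreal (\<integral>z. centered_features.nsq R h z \<partial>G)"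
    if "centered_features G R h" for h :: "'z \<Rightarrow> 'r \<Rightarrow> real" and R
  proof -
    interpret X: centered_features G R h by fact
    have "(\<integral>\<^sup>+p. \<integral>\<^sup>+z. ennreal ((h z p)\<^sup>2) \<partial>G \<partial>R) = (\<integral>\<^sup>+z. \<integral>\<^sup>+p. ennreal ((h z p)\<^sup>2) \<partial>R \<partial>G)"
      by (rule X.GP.Fubini') measurable
    also have "\<dots> = (\<integral>\<^sup>+z. ennreal (X.nsq z) \<partial>G)"
      by (intro nn_integral_cong) (simp add: X.nsq_def nn_integral_eq_integral X.feature_L2)
    also have "\<dots> = ennreal (\<integral>z. X.nsq z \<partial>G)"
      by (rule nn_integral_eq_integral) (simp_all add: X.integrable_nsq X.nsq_nonneg)
    finally show ?thesis .
  qed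
  have "(\<integral>\<^sup>+w. ennreal ((cross w)\<^sup>2) \<partial>(P \<Otimes>\<^sub>M Q)) \<le>
      (\<integral>\<^sup>+w. (\<integral>\<^sup>+z. ennreal ((f z (fst w))\<^sup>2) \<partial>G) * (\<integral>\<^sup>+z. ennreal ((g z (snd w))\<^sup>2) \<partial>G) \<partial>(P \<Otimes>\<^sub>M Q))"
  proof (rule nn_integral_mono)
    fix w assume "w \<in> space (P \<Otimes>\<^sub>M Q)"
    then have w: "fst w \<in> space P" "snd w \<in> space Q" by (auto simp: space_pair_measure)
    then have [measurable]: "(\<lambda>z. f z (fst w)) \<in> borel_measurable G" "(\<lambda>z. g z (snd w)) \<in> borel_measurable G"
      by measurable
    have int: "integrable G (\<lambda>z. f z (fst w) * g z (snd w))"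
      by (rule F.G.integrable_const_bound[where B = 1])
        (auto simp: abs_mult F.feature_bounded H.feature_bounded mult_le_one)
    have "ennreal \<bar>cross w\<bar> \<le> (\<integral>\<^sup>+z. ennreal \<bar>f z (fst w)\<bar> * ennreal \<bar>g z (snd w)\<bar> \<partial>G)"
      using integral_norm_bound_ennreal[OF int] by (simp add: cross_def abs_mult ennreal_mult')
    then have "ennreal ((cross w)\<^sup>2) \<le> (\<integral>\<^sup>+z. ennreal \<bar>f z (fst w)\<bar> * ennreal \<bar>g z (snd w)\<bar> \<partial>G)\<^sup>2"
      using power_mono[of "ennreal \<bar>cross w\<bar>" _ 2] by (simp add: ennreal_power)
    also have "\<dots> \<le> (\<integral>\<^sup>+z. (ennreal \<bar>f z (fst w)\<bar>)\<^sup>2 \<partial>G) * (\<integral>\<^sup>+z. (ennreal \<bar>g z (snd w)\<bar>)\<^sup>2 \<partial>G)"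
      by (rule Cauchy_Schwarz_nn_integral) measurable
    finally show "ennreal ((cross w)\<^sup>2) \<le> (\<integral>\<^sup>+z. ennreal ((f z (fst w))\<^sup>2) \<partial>G) * (\<integral>\<^sup>+z. ennreal ((g z (snd w))\<^sup>2) \<partial>G)"
      by (simp add: ennreal_power)
  qed
  also have "\<dots> = (\<integral>\<^sup>+p. \<integral>\<^sup>+z. ennreal ((f z p)\<^sup>2) \<partial>G \<partial>P) * (\<integral>\<^sup>+q. \<integral>\<^sup>+z. ennreal ((g z q)\<^sup>2) \<partial>G \<partial>Q)"
    by (rule H.P.nn_integral_tensor) measurable
  also have "\<dots> = ennreal (\<integral>z. F.nsq z \<partial>G) * ennreal (\<integral>z. H.nsq z \<partial>G)"
    using swap[OF F.centered_features_axioms] swap[OF H.centered_features_axioms] by simp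
  finally show ?thesis
    by (simp add: ennreal_mult' F.nsq_nonneg)
qed

lemma integrable_cross_sq: "integrable (P \<Otimes>\<^sub>M Q) (\<lambda>w. (cross w)\<^sup>2)"
proof (rule integrableI_bounded)
  show "(\<integral>\<^sup>+w. ennreal (norm ((cross w)\<^sup>2)) \<partial>(P \<Otimes>\<^sub>M Q)) < \<infinity>"
    using nn_integral_cross_sq_le by (simp add: order_le_less_trans[OF _ ennreal_less_top])
qed measurable

lemma integral_cross_sq_le:
  "(\<integral>w. (cross w)\<^sup>2 \<partial>(P \<Otimes>\<^sub>M Q)) \<le> (\<integral>z. F.nsq z \<partial>G) * (\<integral>z. H.nsq z \<partial>G)"
proof -
  have "0 \<le> (\<integral>z. F.nsq z \<partial>G) * (\<integral>z. H.nsq z \<partial>G)"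
    by (simp add: F.nsq_nonneg H.nsq_nonneg)
  with nn_integral_cross_sq_le show ?thesis
    by (simp add: nn_integral_eq_integral[OF integrable_cross_sq])
qed

lemma integrable_tensor_features:
  assumes "z \<in> space G" "z' \<in> space G"
  shows "integrable (P \<Otimes>\<^sub>M Q) (\<lambda>w. f z (fst w) * f z' (fst w) * (g z (snd w) * g z' (snd w)))"
    and "(\<integral>w. f z (fst w) * f z' (fst w) * (g z (snd w) * g z' (snd w)) \<partial>(P \<Otimes>\<^sub>M Q)) = F.ker z z' * H.ker z z'"
  using PQ.integrable_tensor[OF F.integrable_feature_mult[OF assms] H.integrable_feature_mult[OF assms]]
  by (simp_all add: F.ker_def H.ker_def)

lemma integrable_nsq_mult: "integrable G (\<lambda>z. F.nsq z * H.nsq z)"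
  by (intro integrable_mult_of_squares F.integrable_nsq H.integrable_nsq) measurable

lemma tensor_feature_sq:
  assumes "z \<in> space G"
  shows "integrable (P \<Otimes>\<^sub>M Q) (\<lambda>w. (f z (fst w) * g z (snd w))\<^sup>2)"
    and "(\<integral>w. (f z (fst w) * g z (snd w))\<^sup>2 \<partial>(P \<Otimes>\<^sub>M Q)) = F.nsq z * H.nsq z"
  using integrable_tensor_features[OF assms assms]
  by (simp_all add: F.ker_def H.ker_def F.nsq_def H.nsq_def power2_eq_square ac_simps)

lemma tensor_feature_L2:
  "integrable (G \<Otimes>\<^sub>M (P \<Otimes>\<^sub>M Q)) (\<lambda>v. (f (fst v) (fst (snd v)) * g (fst v) (snd (snd v)))\<^sup>2)"
proof (rule GPQ.Fubini_integrable)
  show "integrable G (\<lambda>z. \<integral>w. norm ((f (fst (z, w)) (fst (snd (z, w))) * g (fst (z, w)) (snd (snd (z, w))))\<^sup>2) \<partial>(P \<Otimes>\<^sub>M Q))"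
    using integrable_nsq_mult by (simp add: tensor_feature_sq cong: Bochner_Integration.integrable_cong)
  show "AE z in G. integrable (P \<Otimes>\<^sub>M Q) (\<lambda>w. (f (fst (z, w)) (fst (snd (z, w))) * g (fst (z, w)) (snd (snd (z, w))))\<^sup>2)"
    using tensor_feature_sq(1) by (intro AE_I2) simp
qed measurable

text \<open>
  Fubini's theorem for \<open>\<langle>a, f\<^sub>z \<otimes> g\<^sub>z\<rangle>\<close>; the integrand is dominated by
  \<open>a\<^sup>2 + (f\<^sub>z \<otimes> g\<^sub>z)\<^sup>2\<close>.
\<close>
lemma pairing_cross:
  assumes a[measurable]: "a \<in> borel_measurable (P \<Otimes>\<^sub>M Q)" and a2: "integrable (P \<Otimes>\<^sub>M Q) (\<lambda>w. (a w)\<^sup>2)"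
  shows "integrable G (\<lambda>z. \<integral>w. a w * (f z (fst w) * g z (snd w)) \<partial>(P \<Otimes>\<^sub>M Q))"
    and "(\<integral>z. (\<integral>w. a w * (f z (fst w) * g z (snd w)) \<partial>(P \<Otimes>\<^sub>M Q)) \<partial>G) = (\<integral>w. a w * cross w \<partial>(P \<Otimes>\<^sub>M Q))"
proof -
  have "integrable (G \<Otimes>\<^sub>M (P \<Otimes>\<^sub>M Q)) (\<lambda>v. a (snd v) * (f (fst v) (fst (snd v)) * g (fst v) (snd (snd v))))"
  proof (rule integrable_mult_of_squares[OF _ _ _ tensor_feature_L2])
    show "integrable (G \<Otimes>\<^sub>M (P \<Otimes>\<^sub>M Q)) (\<lambda>v. (a (snd v))\<^sup>2)"
      using GPQ.integrable_tensor(1)[OF F.G.integrable_const[of 1] a2] by simp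
  qed measurable
  then have int: "integrable (G \<Otimes>\<^sub>M (P \<Otimes>\<^sub>M Q)) (\<lambda>(z, w). a w * (f z (fst w) * g z (snd w)))"
    by (simp add: split_beta')
  show "integrable G (\<lambda>z. \<integral>w. a w * (f z (fst w) * g z (snd w)) \<partial>(P \<Otimes>\<^sub>M Q))"
    by (rule GPQ.integrable_fst[OF int])
  show "(\<integral>z. (\<integral>w. a w * (f z (fst w) * g z (snd w)) \<partial>(P \<Otimes>\<^sub>M Q)) \<partial>G) = (\<integral>w. a w * cross w \<partial>(P \<Otimes>\<^sub>M Q))"
    using GPQ.Fubini_integral[OF int] by (simp add: cross_def)
qed

lemma integrable_ker_mult: "integrable (G \<Otimes>\<^sub>M G) (\<lambda>v. F.ker (fst v) (snd v) * H.ker (fst v) (snd v))"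
  by (intro integrable_mult_of_squares F.ker_L2 H.ker_L2) measurable

text \<open>
  Both sides are the integral of
  \<open>(f\<^sub>z \<otimes> g\<^sub>z)(w) (f\<^sub>z\<^sub>' \<otimes> g\<^sub>z\<^sub>')(w)\<close> over \<open>(z, z')\<close> and
  \<open>w\<close>, in the two orders of integration.
\<close>
lemma integral_ker_mult:
  "(\<integral>v. F.ker (fst v) (snd v) * H.ker (fst v) (snd v) \<partial>(G \<Otimes>\<^sub>M G)) = (\<integral>w. (cross w)\<^sup>2 \<partial>(P \<Otimes>\<^sub>M Q))"
proof -
  let ?\<phi> = "\<lambda>z w. f z (fst w) * g z (snd w)"
  have sq: "integrable ((G \<Otimes>\<^sub>M G) \<Otimes>\<^sub>M (P \<Otimes>\<^sub>M Q)) (\<lambda>v. (?\<phi> (\<pi> (fst v)) (snd v))\<^sup>2)"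
    if \<pi>[measurable]: "\<pi> \<in> measurable (G \<Otimes>\<^sub>M G) G"
      and int: "integrable (G \<Otimes>\<^sub>M G) (\<lambda>v. F.nsq (\<pi> v) * H.nsq (\<pi> v))" for \<pi>
  proof (rule GGPQ.Fubini_integrable)
    have eq: "(\<integral>w. norm ((?\<phi> (\<pi> (fst (v, w))) (snd (v, w)))\<^sup>2) \<partial>(P \<Otimes>\<^sub>M Q)) = F.nsq (\<pi> v) * H.nsq (\<pi> v)"
      if "v \<in> space (G \<Otimes>\<^sub>M G)" for v
      using tensor_feature_sq[OF measurable_space[OF \<pi> that]] by simp
    show "integrable (G \<Otimes>\<^sub>M G) (\<lambda>v. \<integral>w. norm ((?\<phi> (\<pi> (fst (v, w))) (snd (v, w)))\<^sup>2) \<partial>(P \<Otimes>\<^sub>M Q))"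
      using int by (subst Bochner_Integration.integrable_cong[OF refl eq])
    show "AE v in G \<Otimes>\<^sub>M G. integrable (P \<Otimes>\<^sub>M Q) (\<lambda>w. (?\<phi> (\<pi> (fst (v, w))) (snd (v, w)))\<^sup>2)"
      using tensor_feature_sq(1)[OF measurable_space[OF \<pi>]] by (intro AE_I2) simp
  qed measurable
  have "integrable ((G \<Otimes>\<^sub>M G) \<Otimes>\<^sub>M (P \<Otimes>\<^sub>M Q)) (\<lambda>v. ?\<phi> (fst (fst v)) (snd v) * ?\<phi> (snd (fst v)) (snd v))"
    by (rule integrable_mult_of_squares[OF _ _
          sq[OF measurable_fst F.GG_integrable(1)[OF integrable_nsq_mult]]
          sq[OF measurable_snd F.GG_integrable(2)[OF integrable_nsq_mult]]]) measurable
  then have int: "integrable ((G \<Otimes>\<^sub>M G) \<Otimes>\<^sub>M (P \<Otimes>\<^sub>M Q)) (\<lambda>(v, w). ?\<phi> (fst v) w * ?\<phi> (snd v) w)"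
    by (simp add: split_beta')
  have "(\<integral>v. F.ker (fst v) (snd v) * H.ker (fst v) (snd v) \<partial>(G \<Otimes>\<^sub>M G)) =
      (\<integral>v. \<integral>w. ?\<phi> (fst v) w * ?\<phi> (snd v) w \<partial>(P \<Otimes>\<^sub>M Q) \<partial>(G \<Otimes>\<^sub>M G))"
    by (intro Bochner_Integration.integral_cong refl)
      (auto simp: space_pair_measure integrable_tensor_features(2)[symmetric] ac_simps)
  also have "\<dots> = (\<integral>w. \<integral>v. ?\<phi> (fst v) w * ?\<phi> (snd v) w \<partial>(G \<Otimes>\<^sub>M G) \<partial>(P \<Otimes>\<^sub>M Q))"
    using GGPQ.Fubini_integral[OF int] by simp
  also have "\<dots> = (\<integral>w. (cross w)\<^sup>2 \<partial>(P \<Otimes>\<^sub>M Q))"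
  proof (intro Bochner_Integration.integral_cong refl)
    fix w assume "w \<in> space (P \<Otimes>\<^sub>M Q)"
    then have w: "fst w \<in> space P" "snd w \<in> space Q" by (auto simp: space_pair_measure)
    then have [measurable]: "(\<lambda>z. f z (fst w)) \<in> borel_measurable G" "(\<lambda>z. g z (snd w)) \<in> borel_measurable G"
      by measurable
    have "integrable G (\<lambda>z. ?\<phi> z w)"
      by (rule F.G.integrable_const_bound[where B = 1])
        (auto simp: abs_mult F.feature_bounded H.feature_bounded mult_le_one)
    from F.GG.integrable_tensor(2)[OF this this]
    show "(\<integral>v. ?\<phi> (fst v) w * ?\<phi> (snd v) w \<partial>(G \<Otimes>\<^sub>M G)) = (cross w)\<^sup>2"
      by (simp add: cross_def power2_eq_square)
  qed
  finally show ?thesis .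
qed

text \<open>
  Expand both squared distances; the four products of a squared norm with a kernel integrate
  to zero by \<open>integral_mult_ker\<close>.
\<close>
lemma integral_sqdist_mult:
  "integrable (G \<Otimes>\<^sub>M G) (\<lambda>v. F.sqdist (fst v) (snd v) * H.sqdist (fst v) (snd v))" (is ?int)
  "(\<integral>v. F.sqdist (fst v) (snd v) * H.sqdist (fst v) (snd v) \<partial>(G \<Otimes>\<^sub>M G)) =
    2 * (\<integral>z. F.nsq z * H.nsq z \<partial>G) + 2 * (\<integral>z. F.nsq z \<partial>G) * (\<integral>z. H.nsq z \<partial>G) +
    4 * (\<integral>w. (cross w)\<^sup>2 \<partial>(P \<Otimes>\<^sub>M Q))" (is ?eq)
proof -
  have eq: "F.sqdist (fst v) (snd v) * H.sqdist (fst v) (snd v) =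
     F.nsq (fst v) * H.nsq (fst v) + F.nsq (snd v) * H.nsq (snd v)
     + F.nsq (fst v) * H.nsq (snd v) + H.nsq (fst v) * F.nsq (snd v)
     - 2 * (F.nsq (fst v) * H.ker (fst v) (snd v)) - 2 * (F.nsq (snd v) * H.ker (fst v) (snd v))
     - 2 * (H.nsq (fst v) * F.ker (fst v) (snd v)) - 2 * (H.nsq (snd v) * F.ker (fst v) (snd v))
     + 4 * (F.ker (fst v) (snd v) * H.ker (fst v) (snd v))" if "v \<in> space (G \<Otimes>\<^sub>M G)" for v
    using that by (auto simp: space_pair_measure F.sqdist_eq H.sqdist_eq algebra_simps)
  note ints = F.GG_integrable[OF integrable_nsq_mult]
    F.GG.integrable_tensor[OF F.integrable_nsq(1) H.integrable_nsq(1)]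
    F.GG.integrable_tensor[OF H.integrable_nsq(1) F.integrable_nsq(1)]
    H.integral_mult_ker[OF F.measurable_nsq F.integrable_nsq(2)]
    F.integral_mult_ker[OF H.measurable_nsq H.integrable_nsq(2)]
    integrable_ker_mult
  show ?int
    using ints by (subst Bochner_Integration.integrable_cong[OF refl eq]) simp_all
  show ?eq
    using ints by (subst Bochner_Integration.integral_cong[OF refl eq]) (simp_all add: integral_ker_mult)
qed

text \<open>
  The abstract form of the expansion of the distortion: the mean squared distances are twice
  the means of the squared norms, so the product of the means absorbs the middle term of the
  previous lemma.
\<close>
lemma integral_sqdist_diff_sq:
  "integrable (G \<Otimes>\<^sub>M G) (\<lambda>v. (F.sqdist (fst v) (snd v) - H.sqdist (fst v) (snd v))\<^sup>2)" (is ?int)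
  "(\<integral>v. (F.sqdist (fst v) (snd v) - H.sqdist (fst v) (snd v))\<^sup>2 \<partial>(G \<Otimes>\<^sub>M G)) =
    (\<integral>v. (F.sqdist (fst v) (snd v))\<^sup>2 \<partial>(G \<Otimes>\<^sub>M G)) + (\<integral>v. (H.sqdist (fst v) (snd v))\<^sup>2 \<partial>(G \<Otimes>\<^sub>M G)) -
    (\<integral>v. F.sqdist (fst v) (snd v) \<partial>(G \<Otimes>\<^sub>M G)) * (\<integral>v. H.sqdist (fst v) (snd v) \<partial>(G \<Otimes>\<^sub>M G)) -
    4 * (\<integral>z. F.nsq z * H.nsq z \<partial>G) - 8 * (\<integral>w. (cross w)\<^sup>2 \<partial>(P \<Otimes>\<^sub>M Q))" (is ?eq)
proof -
  have eq: "(F.sqdist (fst v) (snd v) - H.sqdist (fst v) (snd v))\<^sup>2 =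
      (F.sqdist (fst v) (snd v))\<^sup>2 + (H.sqdist (fst v) (snd v))\<^sup>2 -
      2 * (F.sqdist (fst v) (snd v) * H.sqdist (fst v) (snd v))" for v
    by (simp add: power2_diff)
  show ?int
    unfolding eq using F.sqdist_L2 H.sqdist_L2 integral_sqdist_mult(1) by simp
  show ?eq
    unfolding eq using F.sqdist_L2 H.sqdist_L2 integral_sqdist_mult
    by (simp add: F.integral_sqdist H.integral_sqdist)
qed

end

section \<open>The centered half-space embedding\<close>

lemma measurable_embedding:
  fixes \<rho> :: "'a::euclidean_space measure"
  assumes "prob_space \<rho>" "sets \<rho> = sets borel"
    and g: "g \<in> borel_measurable N" and h: "h \<in> measurable N half_space_measure"
  shows "(\<lambda>w. centered_embedding \<rho> (g w) (h w)) \<in> borel_measurable N"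
proof -
  interpret prob_space \<rho> by fact
  have [measurable_cong]: "sets \<rho> = sets borel" by fact
  have "(\<lambda>\<xi>. \<xi>) \<in> measurable half_space_measure (borel \<Otimes>\<^sub>M borel)"
    by (rule measurable_half_space_measure) simp
  from measurable_compose[OF h this] have [measurable]: "h \<in> measurable N (borel \<Otimes>\<^sub>M borel)"
    by simp
  have [measurable]: "(\<lambda>(\<xi>, x). indicat_real (half_space \<xi>) x) \<in> borel_measurable ((borel \<Otimes>\<^sub>M borel) \<Otimes>\<^sub>M (borel :: 'a measure))"
    unfolding half_space_def indicator_def by measurable
  have [measurable]: "(\<lambda>\<xi>. measure \<rho> (half_space \<xi>)) \<in> borel_measurable (borel \<Otimes>\<^sub>M borel)"
  proof -
    have "(\<lambda>\<xi>. \<integral>x. indicat_real (half_space \<xi>) x \<partial>\<rho>) \<in> borel_measurable (borel \<Otimes>\<^sub>M borel)"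
      by measurable
    then show ?thesis
      using sets_eq_imp_space_eq[OF assms(2)] by simp
  qed
  show ?thesis
    unfolding centered_embedding_def using g by measurable
qed

lemma abs_centered_embedding_le: "prob_space \<rho> \<Longrightarrow> \<bar>centered_embedding \<rho> x \<xi>\<bar> \<le> 1"
  using prob_space.prob_le_1[of \<rho> "half_space \<xi>"] measure_nonneg[of \<rho> "half_space \<xi>"]
  by (auto simp: centered_embedding_def indicator_def)

lemma half_space_sets: "half_space \<xi> \<in> sets borel"
  unfolding half_space_def by measurable

lemma centered_embedding_eq_mean:
  assumes "prob_space \<rho>" "sets \<rho> = sets borel"
  shows "integrable \<rho> (indicat_real (half_space \<xi>))"
    and "centered_embedding \<rho> x \<xi> = (\<integral>y. indicat_real (half_space \<xi>) x - indicat_real (half_space \<xi>) y \<partial>\<rho>)"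
proof -
  interpret prob_space \<rho> by fact
  have [simp]: "space \<rho> = UNIV" using sets_eq_imp_space_eq[OF assms(2)] by simp
  show int: "integrable \<rho> (indicat_real (half_space \<xi>))"
    by (rule integrable_const_bound[where B = 1])
      (simp_all add: half_space_sets measurable_cong_sets[OF assms(2) refl] borel_measurable_indicator)
  show "centered_embedding \<rho> x \<xi> = (\<integral>y. indicat_real (half_space \<xi>) x - indicat_real (half_space \<xi>) y \<partial>\<rho>)"
    using int by (simp add: centered_embedding_def prob_space[simplified])
qed

lemma integral_centered_embedding:
  assumes "prob_space \<rho>" "sets \<rho> = sets borel"
  shows "(\<integral>x. centered_embedding \<rho> x \<xi> \<partial>\<rho>) = 0"
proof -
  interpret prob_space \<rho> by fact
  have [simp]: "space \<rho> = UNIV" using sets_eq_imp_space_eq[OF assms(2)] by simp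
  show ?thesis
    using centered_embedding_eq_mean(1)[OF assms] by (simp add: centered_embedding_def prob_space[simplified])
qed

lemma finite_moment_measuresD:
  assumes "\<rho> \<in> finite_moment_measures 2"
  shows "prob_space \<rho>" "sets \<rho> = sets borel" "integrable \<rho> (\<lambda>x. (norm x)\<^sup>2)" "integrable \<rho> norm"
proof -
  show 1: "prob_space \<rho>" and 2: "sets \<rho> = sets borel"
    using assms by (auto simp: finite_moment_measures_def)
  interpret prob_space \<rho> by fact
  have [measurable_cong]: "sets \<rho> = sets borel" by fact
  have "norm x powr 2 = (norm x)\<^sup>2" for x :: 'a by simp
  then show 3: "integrable \<rho> (\<lambda>x. (norm x)\<^sup>2)"
    using assms by (simp add: finite_moment_measures_def)
  show "integrable \<rho> norm"
    by (rule square_integrable_imp_integrable[OF _ 3]) measurable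
qed

text \<open>
  \<open>U\<^sub>x\<close> is the \<open>\<rho>\<close>-mean over \<open>y\<close> of the difference of the indicators at \<open>x\<close> and \<open>y\<close>. By
  Jensen's inequality and the Crofton formula \<open>\<parallel>U\<^sub>x\<parallel>\<^sup>2\<close> is at most the mean of \<open>\<parallel>x - y\<parallel>\<close>.
  Hence \<open>\<parallel>U\<^sub>x\<parallel>\<^sup>2\<close> grows linearly, and a second moment of \<open>\<rho>\<close> makes its square integrable.
\<close>
lemma nn_integral_embedding_sq_le:
  fixes \<rho> :: "'a::euclidean_space measure"
  assumes \<rho>: "\<rho> \<in> finite_moment_measures 2"
  shows "(\<integral>\<^sup>+\<xi>. ennreal ((centered_embedding \<rho> x \<xi>)\<^sup>2) \<partial>half_space_measure) \<le>
    ennreal (norm x + (\<integral>y. norm y \<partial>\<rho>))"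
proof -
  note fm = finite_moment_measuresD[OF \<rho>]
  interpret prob_space \<rho> by fact
  interpret W: sigma_finite_measure "half_space_measure :: ('a \<times> real) measure"
    by (rule sigma_finite_half_space_measure)
  interpret WR: pair_sigma_finite "half_space_measure :: ('a \<times> real) measure" \<rho> ..
  have [measurable_cong]: "sets \<rho> = sets borel" by fact
  let ?I = "\<lambda>\<xi> x. indicat_real (half_space \<xi>) x"
  have [measurable]: "(\<lambda>\<xi>. \<xi>) \<in> measurable half_space_measure (borel \<Otimes>\<^sub>M borel)"
    by (rule measurable_half_space_measure) simp
  have I: "(\<lambda>(\<xi>, y). (?I \<xi> x - ?I \<xi> y)\<^sup>2) \<in> borel_measurable ((borel \<Otimes>\<^sub>M borel) \<Otimes>\<^sub>M borel)"
    unfolding half_space_def indicator_def by measurable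
  have "(\<lambda>w. (fst w, snd w)) \<in> measurable (half_space_measure \<Otimes>\<^sub>M \<rho>) ((borel \<Otimes>\<^sub>M borel) \<Otimes>\<^sub>M borel)"
    by measurable
  from measurable_compose[OF this I]
  have [measurable]: "(\<lambda>(\<xi>, y). (?I \<xi> x - ?I \<xi> y)\<^sup>2) \<in> borel_measurable (half_space_measure \<Otimes>\<^sub>M \<rho>)"
    by (simp add: split_beta')
  have "(\<integral>\<^sup>+\<xi>. ennreal ((centered_embedding \<rho> x \<xi>)\<^sup>2) \<partial>half_space_measure) \<le>
      (\<integral>\<^sup>+\<xi>. \<integral>\<^sup>+y. ennreal ((?I \<xi> x - ?I \<xi> y)\<^sup>2) \<partial>\<rho> \<partial>half_space_measure)"
  proof (rule nn_integral_mono)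
    fix \<xi> :: "'a \<times> real"
    have [measurable]: "half_space \<xi> \<in> sets borel" by (rule half_space_sets)
    have int: "integrable \<rho> (\<lambda>y. (?I \<xi> x - ?I \<xi> y)\<^sup>2)"
      by (rule integrable_const_bound[where B = 1]) (auto simp: indicator_def)
    have "(centered_embedding \<rho> x \<xi>)\<^sup>2 \<le> (\<integral>y. (?I \<xi> x - ?I \<xi> y)\<^sup>2 \<partial>\<rho>)"
      unfolding centered_embedding_eq_mean(2)[OF fm(1,2)]
      by (rule expectation_square_le[OF _ int]) measurable
    then show "ennreal ((centered_embedding \<rho> x \<xi>)\<^sup>2) \<le> (\<integral>\<^sup>+y. ennreal ((?I \<xi> x - ?I \<xi> y)\<^sup>2) \<partial>\<rho>)"
      by (subst nn_integral_eq_integral[OF int]) (simp_all add: ennreal_leI)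
  qed
  also have "\<dots> = (\<integral>\<^sup>+y. \<integral>\<^sup>+\<xi>. ennreal ((?I \<xi> x - ?I \<xi> y)\<^sup>2) \<partial>half_space_measure \<partial>\<rho>)"
    by (rule WR.Fubini'[symmetric]) measurable
  also have "\<dots> = (\<integral>\<^sup>+y. ennreal (norm (x - y)) \<partial>\<rho>)"
    by (simp only: half_space_crofton)
  also have "\<dots> \<le> (\<integral>\<^sup>+y. ennreal (norm x + norm y) \<partial>\<rho>)"
    by (intro nn_integral_mono ennreal_leI norm_triangle_ineq4)
  also have "\<dots> = ennreal (norm x + (\<integral>y. norm y \<partial>\<rho>))"
    using fm(4) by (subst nn_integral_eq_integral) (simp_all add: prob_space)
  finally show ?thesis .
qed

lemma embedding_norm_sq_eq: "embedding_norm_sq \<rho> x = (\<integral>\<xi>. (centered_embedding \<rho> x \<xi>)\<^sup>2 \<partial>half_space_measure)"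
  by (simp add: embedding_norm_sq_def L2_norm_on_def)

lemma embedding_L2:
  fixes \<rho> :: "'a::euclidean_space measure"
  assumes \<rho>: "\<rho> \<in> finite_moment_measures 2"
  shows "integrable half_space_measure (\<lambda>\<xi>. (centered_embedding \<rho> x \<xi>)\<^sup>2)"
    and "embedding_norm_sq \<rho> x \<le> norm x + (\<integral>y. norm y \<partial>\<rho>)"
proof -
  note fm = finite_moment_measuresD[OF \<rho>]
  have [measurable]: "centered_embedding \<rho> x \<in> borel_measurable half_space_measure"
    by (rule measurable_embedding[OF fm(1,2), of "\<lambda>_. x" _ "\<lambda>\<xi>. \<xi>"]) simp_all
  show int: "integrable half_space_measure (\<lambda>\<xi>. (centered_embedding \<rho> x \<xi>)\<^sup>2)"
  proof (rule integrableI_bounded)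
    show "(\<integral>\<^sup>+\<xi>. ennreal (norm ((centered_embedding \<rho> x \<xi>)\<^sup>2)) \<partial>half_space_measure) < \<infinity>"
      using order_le_less_trans[OF nn_integral_embedding_sq_le[OF \<rho>, of x] ennreal_less_top] by simp
  qed measurable
  have "0 \<le> norm x + (\<integral>y. norm y \<partial>\<rho>)" by simp
  then show "embedding_norm_sq \<rho> x \<le> norm x + (\<integral>y. norm y \<partial>\<rho>)"
    using nn_integral_embedding_sq_le[OF \<rho>, of x]
    by (simp add: nn_integral_eq_integral[OF int] embedding_norm_sq_eq del: ennreal_plus)
qed

text \<open>
  The centering cancels in the difference.
\<close>
lemma embedding_sqdist:
  fixes \<rho> :: "'a::euclidean_space measure"
  shows "(\<integral>\<xi>. (centered_embedding \<rho> x \<xi> - centered_embedding \<rho> y \<xi>)\<^sup>2 \<partial>half_space_measure) = norm (x - y)"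
proof -
  have [measurable]: "(\<lambda>\<xi>. (indicat_real (half_space \<xi>) x - indicat_real (half_space \<xi>) y)\<^sup>2) \<in> borel_measurable half_space_measure"
    by (rule measurable_half_space_measure) (unfold half_space_def indicator_def, measurable)
  show ?thesis
    using half_space_crofton[of x y]
    by (simp add: centered_embedding_def integral_eq_nn_integral)
qed

lemma measurable_embedding_norm_sq:
  fixes \<rho> :: "'a::euclidean_space measure"
  assumes "prob_space \<rho>" "sets \<rho> = sets borel"
  shows "embedding_norm_sq \<rho> \<in> borel_measurable borel"
proof -
  interpret W: sigma_finite_measure "half_space_measure :: ('a \<times> real) measure"
    by (rule sigma_finite_half_space_measure)
  have "(\<lambda>w. centered_embedding \<rho> (fst w) (snd w)) \<in> borel_measurable (borel \<Otimes>\<^sub>M half_space_measure)"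
    by (rule measurable_embedding[OF assms]) measurable
  then have [measurable]: "(\<lambda>(x, \<xi>). centered_embedding \<rho> x \<xi>) \<in> borel_measurable (borel \<Otimes>\<^sub>M half_space_measure)"
    by (simp add: split_beta')
  show ?thesis
    unfolding embedding_norm_sq_eq[abs_def] by measurable
qed

lemma integrable_embedding_norm_sq_sq:
  assumes \<rho>: "\<rho> \<in> finite_moment_measures 2"
  shows "integrable \<rho> (\<lambda>x. (embedding_norm_sq \<rho> x)\<^sup>2)"
proof -
  note fm = finite_moment_measuresD[OF \<rho>]
  interpret prob_space \<rho> by fact
  have [measurable_cong]: "sets \<rho> = sets borel" by fact
  have [measurable]: "embedding_norm_sq \<rho> \<in> borel_measurable borel"
    by (rule measurable_embedding_norm_sq[OF fm(1,2)])
  show ?thesis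
  proof (rule Bochner_Integration.integrable_bound)
    show "integrable \<rho> (\<lambda>x. (norm x + (\<integral>y. norm y \<partial>\<rho>))\<^sup>2)"
      using fm(3) by (intro integrable_square_add) simp_all
    show "AE x in \<rho>. norm ((embedding_norm_sq \<rho> x)\<^sup>2) \<le> norm ((norm x + (\<integral>y. norm y \<partial>\<rho>))\<^sup>2)"
      using embedding_L2(2)[OF \<rho>]
      by (intro AE_I2) (simp add: power_mono embedding_norm_sq_eq)
  qed measurable
qed

text \<open>
  The embedding is read off along a random variable \<open>\<pi>\<close> with law \<open>\<rho>\<close>, so that both
  marginals of a coupling yield features over the same probability space.
\<close>
lemma centered_features_embedding:
  fixes \<pi> :: "'z \<Rightarrow> 'a::euclidean_space"
  assumes "prob_space G" and \<pi>[measurable]: "\<pi> \<in> borel_measurable G"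
    and \<rho>: "distr G borel \<pi> \<in> finite_moment_measures 2"
  shows "centered_features G half_space_measure (\<lambda>z. centered_embedding (distr G borel \<pi>) (\<pi> z))"
proof -
  note fm = finite_moment_measuresD[OF \<rho>]
  interpret G: prob_space G by fact
  interpret W: sigma_finite_measure "half_space_measure :: ('a \<times> real) measure"
    by (rule sigma_finite_half_space_measure)
  show ?thesis
  proof
    have "(\<lambda>w. centered_embedding (distr G borel \<pi>) (\<pi> (fst w)) (snd w)) \<in> borel_measurable (G \<Otimes>\<^sub>M half_space_measure)"
      by (rule measurable_embedding[OF fm(1,2)]) measurable
    then show "(\<lambda>(z, y). centered_embedding (distr G borel \<pi>) (\<pi> z) y) \<in> borel_measurable (G \<Otimes>\<^sub>M half_space_measure)"
      by (simp add: split_beta')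
    fix p :: "'a \<times> real" assume p: "p \<in> space half_space_measure"
    have "(\<lambda>x. centered_embedding (distr G borel \<pi>) x p) \<in> borel_measurable borel"
      using p by (intro measurable_embedding[OF fm(1,2)]) measurable
    then have "(\<integral>x. centered_embedding (distr G borel \<pi>) x p \<partial>distr G borel \<pi>) =
      (\<integral>z. centered_embedding (distr G borel \<pi>) (\<pi> z) p \<partial>G)"
      by (rule integral_distr[OF \<pi>])
    then show "(\<integral>z. centered_embedding (distr G borel \<pi>) (\<pi> z) p \<partial>G) = 0"
      by (simp add: integral_centered_embedding[OF fm(1,2)])
  next
    show "integrable G (\<lambda>z. (\<integral>p. (centered_embedding (distr G borel \<pi>) (\<pi> z) p)\<^sup>2 \<partial>half_space_measure)\<^sup>2)"
      using integrable_distr[OF \<pi> integrable_embedding_norm_sq_sq[OF \<rho>]]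
      by (simp add: embedding_norm_sq_eq)
  qed (use abs_centered_embedding_le[OF fm(1)] embedding_L2(1)[OF \<rho>] in auto)
qed

section \<open>Couplings and the dual formula\<close>

text \<open>
  The product measure is a coupling.
\<close>
lemma couplings_nonempty:
  fixes \<mu> :: "'a::euclidean_space measure" and \<nu> :: "'b::euclidean_space measure"
  assumes "prob_space \<mu>" "sets \<mu> = sets borel" "prob_space \<nu>" "sets \<nu> = sets borel"
  shows "couplings \<mu> \<nu> \<noteq> {}"
proof -
  interpret M: prob_space \<mu> by fact
  interpret N: prob_space \<nu> by fact
  interpret MN: pair_prob_space \<mu> \<nu> ..
  have s: "sets (\<mu> \<Otimes>\<^sub>M \<nu>) = sets (borel :: ('a \<times> 'b) measure)"
    using assms by (simp add: borel_prod[symmetric] cong: sets_pair_measure_cong)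
  have "distr (\<mu> \<Otimes>\<^sub>M \<nu>) borel fst = \<mu>"
    using N.distr_pair_fst[of \<mu>] assms by (simp cong: distr_cong)
  moreover have "distr (\<mu> \<Otimes>\<^sub>M \<nu>) borel snd = \<nu>"
  proof -
    have "distr (\<mu> \<Otimes>\<^sub>M \<nu>) borel snd = distr (distr (\<nu> \<Otimes>\<^sub>M \<mu>) (\<mu> \<Otimes>\<^sub>M \<nu>) (\<lambda>(x, y). (y, x))) borel snd"
      by (subst MN.distr_pair_swap) simp
    also have "\<dots> = distr (\<nu> \<Otimes>\<^sub>M \<mu>) borel fst"
      using assms by (subst distr_distr) (auto simp: comp_def split_beta' measurable_cong_sets[OF refl assms(4)[symmetric]])
    also have "\<dots> = \<nu>"
      using M.distr_pair_fst[of \<nu>] assms by (simp cong: distr_cong)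
    finally show ?thesis .
  qed
  ultimately have "\<mu> \<Otimes>\<^sub>M \<nu> \<in> couplings \<mu> \<nu>"
    using s MN.prob_space_axioms by (simp add: couplings_def)
  then show ?thesis by blast
qed

locale gw_coupling =
  fixes \<mu> :: "'a::euclidean_space measure" and \<nu> :: "'b::euclidean_space measure"
    and \<gamma> :: "('a \<times> 'b) measure"
  assumes \<mu>: "\<mu> \<in> finite_moment_measures 2" and \<nu>: "\<nu> \<in> finite_moment_measures 2"
    and \<gamma>: "\<gamma> \<in> couplings \<mu> \<nu>"
begin

lemma marginals: "distr \<gamma> borel fst = \<mu>" "distr \<gamma> borel snd = \<nu>"
  and sets_\<gamma> [measurable_cong]: "sets \<gamma> = sets borel" and prob_\<gamma>: "prob_space \<gamma>"
  using \<gamma> by (auto simp: couplings_def)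

lemma space_\<gamma> [simp]: "space \<gamma> = UNIV"
  using sets_eq_imp_space_eq[OF sets_\<gamma>] by simp

lemma projections [measurable]: "fst \<in> borel_measurable \<gamma>" "snd \<in> borel_measurable \<gamma>"
  by (simp_all add: measurable_cong_sets[OF sets_\<gamma> refl] borel_measurable_continuous_onI continuous_on_fst continuous_on_snd continuous_on_id)

abbreviation "U z \<equiv> centered_embedding \<mu> (fst z)"
abbreviation "V z \<equiv> centered_embedding \<nu> (snd z)"

sublocale centered_feature_pair \<gamma> half_space_measure half_space_measure U V
proof (intro centered_feature_pair.intro)
  show "centered_features \<gamma> half_space_measure U"
    using centered_features_embedding[OF prob_\<gamma> projections(1)] \<mu> by (simp add: marginals)
  show "centered_features \<gamma> half_space_measure V"
    using centered_features_embedding[OF prob_\<gamma> projections(2)] \<nu> by (simp add: marginals)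
qed

lemma feature_simps:
  "F.nsq z = embedding_norm_sq \<mu> (fst z)" "H.nsq z = embedding_norm_sq \<nu> (snd z)"
  "F.sqdist z z' = norm (fst z - fst z')" "H.sqdist z z' = norm (snd z - snd z')"
  by (simp_all add: F.nsq_def H.nsq_def F.sqdist_def H.sqdist_def embedding_norm_sq_eq embedding_sqdist)

lemma integral_marginals:
  fixes h :: "'a \<Rightarrow> real" and k :: "'b \<Rightarrow> real"
  shows "h \<in> borel_measurable borel \<Longrightarrow> (\<integral>x. h x \<partial>\<mu>) = (\<integral>z. h (fst z) \<partial>\<gamma>)"
    and "k \<in> borel_measurable borel \<Longrightarrow> (\<integral>y. k y \<partial>\<nu>) = (\<integral>z. k (snd z) \<partial>\<gamma>)"
  using integral_distr[OF projections(1), of h] integral_distr[OF projections(2), of k]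
  by (simp_all add: marginals)

lemma measurable_embedding_norm_sq [measurable]:
  "embedding_norm_sq \<mu> \<in> borel_measurable borel" "embedding_norm_sq \<nu> \<in> borel_measurable borel"
  using measurable_embedding_norm_sq[OF finite_moment_measuresD(1,2)[OF \<mu>]]
    measurable_embedding_norm_sq[OF finite_moment_measuresD(1,2)[OF \<nu>]] .

lemma mean_embedding_norm_sq_eq:
  "mean_embedding_norm_sq \<mu> = (\<integral>z. F.nsq z \<partial>\<gamma>)" "mean_embedding_norm_sq \<nu> = (\<integral>z. H.nsq z \<partial>\<gamma>)"
  by (simp_all add: mean_embedding_norm_sq_def feature_simps integral_marginals)

lemma double_integral_marginals:
  fixes k :: "real \<Rightarrow> real"
  assumes [measurable]: "k \<in> borel_measurable borel"
  shows "integrable (\<gamma> \<Otimes>\<^sub>M \<gamma>) (\<lambda>v. k (F.sqdist (fst v) (snd v))) \<Longrightarrow>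
     (\<integral>x. (\<integral>x'. k (norm (x - x')) \<partial>\<mu>) \<partial>\<mu>) = (\<integral>v. k (F.sqdist (fst v) (snd v)) \<partial>(\<gamma> \<Otimes>\<^sub>M \<gamma>))"
   and "integrable (\<gamma> \<Otimes>\<^sub>M \<gamma>) (\<lambda>v. k (H.sqdist (fst v) (snd v))) \<Longrightarrow>
     (\<integral>y. (\<integral>y'. k (norm (y - y')) \<partial>\<nu>) \<partial>\<nu>) = (\<integral>v. k (H.sqdist (fst v) (snd v)) \<partial>(\<gamma> \<Otimes>\<^sub>M \<gamma>))"
proof -
  interpret M: prob_space \<mu> by (rule finite_moment_measuresD(1)[OF \<mu>])
  interpret N: prob_space \<nu> by (rule finite_moment_measuresD(1)[OF \<nu>])
  have [measurable_cong]: "sets \<mu> = sets borel" "sets \<nu> = sets borel"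
    using finite_moment_measuresD(2) \<mu> \<nu> by auto
  have *: "(\<integral>x. (\<integral>x'. k (norm (x - x')) \<partial>\<mu>) \<partial>\<mu>) = (\<integral>z. \<integral>z'. k (norm (fst z - fst z')) \<partial>\<gamma> \<partial>\<gamma>)"
    by (subst (1 2) integral_marginals) measurable
  have **: "(\<integral>y. (\<integral>y'. k (norm (y - y')) \<partial>\<nu>) \<partial>\<nu>) = (\<integral>z. \<integral>z'. k (norm (snd z - snd z')) \<partial>\<gamma> \<partial>\<gamma>)"
    by (subst (1 2) integral_marginals) measurable
  show "integrable (\<gamma> \<Otimes>\<^sub>M \<gamma>) (\<lambda>v. k (F.sqdist (fst v) (snd v))) \<Longrightarrow>
     (\<integral>x. (\<integral>x'. k (norm (x - x')) \<partial>\<mu>) \<partial>\<mu>) = (\<integral>v. k (F.sqdist (fst v) (snd v)) \<partial>(\<gamma> \<Otimes>\<^sub>M \<gamma>))"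
    unfolding * by (drule F.GG.integral_fst') (simp add: feature_simps)
  show "integrable (\<gamma> \<Otimes>\<^sub>M \<gamma>) (\<lambda>v. k (H.sqdist (fst v) (snd v))) \<Longrightarrow>
     (\<integral>y. (\<integral>y'. k (norm (y - y')) \<partial>\<nu>) \<partial>\<nu>) = (\<integral>v. k (H.sqdist (fst v) (snd v)) \<partial>(\<gamma> \<Otimes>\<^sub>M \<gamma>))"
    unfolding ** by (drule F.GG.integral_fst') (simp add: feature_simps)
qed

text \<open>
  The part of the distortion that depends on the coupling.
\<close>
definition reduced :: real where
  "reduced = - 4 * (\<integral>z. F.nsq z * H.nsq z \<partial>\<gamma>) - 8 * (\<integral>w. (cross w)\<^sup>2 \<partial>half_space_pair_measure)"

lemma distortion_eq:
  "(\<integral>(x, y). (\<integral>(x', y'). \<bar>norm (x - x') - norm (y - y')\<bar>\<^sup>2 \<partial>\<gamma>) \<partial>\<gamma>) = gw_const \<mu> \<nu> + reduced"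
proof -
  have int: "integrable (\<gamma> \<Otimes>\<^sub>M \<gamma>) (\<lambda>v. F.sqdist (fst v) (snd v))" "integrable (\<gamma> \<Otimes>\<^sub>M \<gamma>) (\<lambda>v. H.sqdist (fst v) (snd v))"
    using F.integrable_sqdist H.integrable_sqdist by simp_all
  have "(\<integral>(x, y). (\<integral>(x', y'). \<bar>norm (x - x') - norm (y - y')\<bar>\<^sup>2 \<partial>\<gamma>) \<partial>\<gamma>) =
      (\<integral>v. (F.sqdist (fst v) (snd v) - H.sqdist (fst v) (snd v))\<^sup>2 \<partial>(\<gamma> \<Otimes>\<^sub>M \<gamma>))"
    using F.GG.integral_fst'[OF integral_sqdist_diff_sq(1)]
    by (simp add: feature_simps split_beta')
  then show ?thesis
    using double_integral_marginals[of "\<lambda>r. r\<^sup>2"] double_integral_marginals[of "\<lambda>r. r"] int F.sqdist_L2 H.sqdist_L2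
    by (simp add: integral_sqdist_diff_sq gw_const_def reduced_def half_space_pair_measure_def)
qed

text \<open>
  Completing the square in \<open>\<parallel>a\<parallel>\<^sup>2/8 - 2\<langle>a, K\<rangle>\<close>. The two properties needed of the dual
  objective, that \<open>reduced\<close> is a lower bound and that it is attained at \<open>a = 8K\<close>, can be read
  off.
\<close>
lemma dual_objective_eq:
  assumes a: "a \<in> L2_space half_space_pair_measure"
  shows "1 / 8 * (L2_norm_on half_space_pair_measure a)\<^sup>2 + (\<integral>(x, y). dual_cost a \<mu> \<nu> x y \<partial>\<gamma>) =
    reduced + 1 / 8 * (\<integral>w. (a w - 8 * cross w)\<^sup>2 \<partial>half_space_pair_measure)"
proof -
  let ?W = "half_space_pair_measure :: (('a \<times> real) \<times> ('b \<times> real)) measure"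
  have W: "?W = half_space_measure \<Otimes>\<^sub>M half_space_measure" by (simp add: half_space_pair_measure_def)
  have am: "a \<in> borel_measurable ?W" and a2: "integrable ?W (\<lambda>w. (a w)\<^sup>2)"
    using a by (auto simp: L2_space_def)
  have [measurable]: "cross \<in> borel_measurable ?W" unfolding W by measurable
  have K2: "integrable ?W (\<lambda>w. (cross w)\<^sup>2)" unfolding W by (rule integrable_cross_sq)
  have aK: "integrable ?W (\<lambda>w. a w * cross w)"
    by (rule integrable_mult_of_squares[OF am _ a2 K2]) measurable
  note pair = pairing_cross[OF am[unfolded W] a2[unfolded W], folded W]
  have "(\<integral>(x, y). dual_cost a \<mu> \<nu> x y \<partial>\<gamma>) =
      (\<integral>z. - 4 * (F.nsq z * H.nsq z) - 2 * (\<integral>w. a w * (U z (fst w) * V z (snd w)) \<partial>?W) \<partial>\<gamma>)"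
    by (simp add: dual_cost_def split_beta' feature_simps mult.assoc)
  also have "\<dots> = - 4 * (\<integral>z. F.nsq z * H.nsq z \<partial>\<gamma>) - 2 * (\<integral>w. a w * cross w \<partial>?W)"
    using pair integrable_nsq_mult by simp
  finally have cost: "(\<integral>(x, y). dual_cost a \<mu> \<nu> x y \<partial>\<gamma>) = \<dots>" .
  have "(\<integral>w. (a w - 8 * cross w)\<^sup>2 \<partial>?W) = (\<integral>w. (a w)\<^sup>2 - 16 * (a w * cross w) + 64 * (cross w)\<^sup>2 \<partial>?W)"
    by (simp add: power2_diff power_mult_distrib algebra_simps)
  also have "\<dots> = (\<integral>w. (a w)\<^sup>2 \<partial>?W) - 16 * (\<integral>w. a w * cross w \<partial>?W) + 64 * (\<integral>w. (cross w)\<^sup>2 \<partial>?W)"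
    using a2 aK K2 by simp
  finally show ?thesis
    unfolding cost by (simp add: reduced_def L2_norm_on_def field_simps)
qed

lemma optimal_dual: "(\<lambda>w. 8 * cross w) \<in> dual_ball \<mu> \<nu>"
proof -
  have m: "(\<lambda>w. 8 * cross w) \<in> L2_space half_space_pair_measure"
    using integrable_cross_sq measurable_cross
    by (auto simp: L2_space_def half_space_pair_measure_def power_mult_distrib)
  have "L2_norm_on half_space_pair_measure (\<lambda>w. 8 * cross w) =
      8 * sqrt (\<integral>w. (cross w)\<^sup>2 \<partial>half_space_pair_measure)"
    by (simp add: L2_norm_on_def power_mult_distrib real_sqrt_mult real_sqrt_unique[of 8])
  also have "\<dots> \<le> 8 * sqrt (mean_embedding_norm_sq \<mu> * mean_embedding_norm_sq \<nu>)"
    using integral_cross_sq_le by (simp add: mean_embedding_norm_sq_eq half_space_pair_measure_def)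
  finally show ?thesis using m by (simp add: dual_ball_def)
qed

text \<open>
  The bound contains the marginals only and therefore holds for all couplings at once.
\<close>
lemma reduced_ge:
  "- 4 * ((\<integral>x. (embedding_norm_sq \<mu> x)\<^sup>2 \<partial>\<mu>) + (\<integral>y. (embedding_norm_sq \<nu> y)\<^sup>2 \<partial>\<nu>))
    - 8 * (mean_embedding_norm_sq \<mu> * mean_embedding_norm_sq \<nu>) \<le> reduced"
proof -
  have "(\<integral>z. F.nsq z * H.nsq z \<partial>\<gamma>) \<le> (\<integral>z. (F.nsq z)\<^sup>2 + (H.nsq z)\<^sup>2 \<partial>\<gamma>)"
    using integrable_nsq_mult F.integrable_nsq H.integrable_nsq abs_mult_le_sum_squares
    by (intro integral_mono) (auto intro: order_trans[OF abs_ge_self])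
  also have "\<dots> = (\<integral>x. (embedding_norm_sq \<mu> x)\<^sup>2 \<partial>\<mu>) + (\<integral>y. (embedding_norm_sq \<nu> y)\<^sup>2 \<partial>\<nu>)"
    using F.integrable_nsq H.integrable_nsq by (simp add: feature_simps integral_marginals)
  finally show ?thesis
    using integral_cross_sq_le
    by (simp add: reduced_def mean_embedding_norm_sq_eq half_space_pair_measure_def)
qed

end

theorem theorem4p1:
  fixes \<mu> :: "(real ^ 'm) measure" and \<nu> :: "(real ^ 'n) measure"
  assumes "\<mu> \<in> finite_moment_measures 2" and "\<nu> \<in> finite_moment_measures 2"
  shows "gw2_sq \<mu> \<nu> =
    gw_const \<mu> \<nu> +
    (INF a \<in> dual_ball \<mu> \<nu>.
       1 / 8 * (L2_norm_on half_space_pair_measure a)\<^sup>2 +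
       transport_cost (dual_cost a \<mu> \<nu>) \<mu> \<nu>)"
proof -
  have loc: "gw_coupling \<mu> \<nu> \<gamma>" if "\<gamma> \<in> couplings \<mu> \<nu>" for \<gamma>
    using assms that by unfold_locales
  let ?m = "\<lambda>\<gamma> w. 8 * centered_feature_pair.cross \<gamma> (\<lambda>z. centered_embedding \<mu> (fst z)) (\<lambda>z. centered_embedding \<nu> (snd z)) w"
  let ?J = "gw_coupling.reduced \<mu> \<nu>"
  have "gw2_sq \<mu> \<nu> = (INF \<gamma>\<in>couplings \<mu> \<nu>. gw_const \<mu> \<nu> + ?J \<gamma>)"
    unfolding gw2_sq_def by (intro INF_cong refl gw_coupling.distortion_eq loc)
  also have "\<dots> = gw_const \<mu> \<nu> + (INF a\<in>dual_ball \<mu> \<nu>. 1 / 8 * (L2_norm_on half_space_pair_measure a)\<^sup>2 +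
      (INF \<gamma>\<in>couplings \<mu> \<nu>. \<integral>(x, y). dual_cost a \<mu> \<nu> x y \<partial>\<gamma>))"
  proof (rule INF_swap_attained[where m = ?m])
    show "couplings \<mu> \<nu> \<noteq> {}"
      by (rule couplings_nonempty[OF finite_moment_measuresD(1,2)[OF assms(1)] finite_moment_measuresD(1,2)[OF assms(2)]])
  next
    fix \<gamma> assume "\<gamma> \<in> couplings \<mu> \<nu>"
    then interpret gw_coupling \<mu> \<nu> \<gamma> by (rule loc)
    have "(\<lambda>w. 8 * cross w) \<in> L2_space half_space_pair_measure"
      using optimal_dual by (simp add: dual_ball_def)
    from dual_objective_eq[OF this] optimal_dual
    show "?m \<gamma> \<in> dual_ball \<mu> \<nu> \<and>
      1 / 8 * (L2_norm_on half_space_pair_measure (?m \<gamma>))\<^sup>2 +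
      (\<integral>(x, y). dual_cost (?m \<gamma>) \<mu> \<nu> x y \<partial>\<gamma>) = ?J \<gamma>"
      by simp
    fix a assume "a \<in> dual_ball \<mu> \<nu>"
    then have "a \<in> L2_space half_space_pair_measure" by (simp add: dual_ball_def)
    from dual_objective_eq[OF this]
    show "?J \<gamma> \<le> 1 / 8 * (L2_norm_on half_space_pair_measure a)\<^sup>2 + (\<integral>(x, y). dual_cost a \<mu> \<nu> x y \<partial>\<gamma>)"
      by simp
  next
    fix \<gamma> assume "\<gamma> \<in> couplings \<mu> \<nu>"
    then interpret gw_coupling \<mu> \<nu> \<gamma> by (rule loc)
    show "- 4 * ((\<integral>x. (embedding_norm_sq \<mu> x)\<^sup>2 \<partial>\<mu>) + (\<integral>y. (embedding_norm_sq \<nu> y)\<^sup>2 \<partial>\<nu>))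
      - 8 * (mean_embedding_norm_sq \<mu> * mean_embedding_norm_sq \<nu>) \<le> ?J \<gamma>"
      by (rule reduced_ge)
  qed
  finally show ?thesis by (simp add: transport_cost_def)
qed

end
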